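(* For every graph $H$ with $V(H)=[m]$ and every $\gamma>0$, there exist $\varepsilon,c>0$ such that the following holds for all $0<p\le 1$. Let $G$ and $\Gamma$ be graphs with $G\subseteq\Gamma$, and let $V_1,\dots,V_m$ be subsets of $V(G)$. Suppose that for each edge $ij\in E(H)$ the sets $V_i$ and $V_j$ are disjoint, and the pair $(V_i,V_j)$ is $(\varepsilon,p)$-regular in $G$ and $\big(p,\,c\,p^{k_{\mathrm{reg}}(H)}\sqrt{|V_i||V_j|}\big)$-bijumbled in $\Gamma$. Then $$n(H;G)\ \ge\ \big(d(H;G)-\gamma\big)\,p^{e(H)}\prod_{i\in V(H)}|V_i|\,.$$
   Context: Graphs are finite and simple; $[m]=\{1,\dots,m\}$; $e(H)$ is the number of edges of $H$; $e(U,W)$ is the number of edges between disjoint vertex sets $U$ and $W$. Bijumbled: a pair $(U,V)$ of disjoint vertex sets of $\Gamma$ is $(p,\gamma)$-bijumbled in $\Gamma$ if for all $U'\subseteq U$ and $V'\subseteq V$ we have $\big|e_\Gamma(U',V')-p|U'||V'|\big|\le\gamma\sqrt{|U'||V'|}$. Sparse regularity: the $p$-density of a pair $(U,W)$ of disjoint nonempty vertex sets in $G$ is $d_p(U,W)=e_G(U,W)/(p|U||W|)$. The pair is $(\varepsilon,p)$-regular in $G$ if $|d_p(U',W')-d_p(U,W)|\le\varepsilon$ for all $U'\subseteq U$, $W'\subseteq W$ with $|U'|\ge\varepsilon|U|$, $|W'|\ge\varepsilon|W|$. Counts: given $V_1,\dots,V_m$, $n(H;G)$ is the number of labelled copies of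 $H$ in $G$ with $i$ in $V_i$ for each $i$, that is, the number of maps $\phi:[m]\to V(G)$ with $\phi(i)\in V_i$ for all $i$ and $\phi(i)\phi(j)\in E(G)$ for all $ij\in E(H)$. Moreover $d(H;G)=\prod_{ij\in E(H)}d_p(V_i,V_j)$, the $p$-densities being taken in $G$. The parameter $k_{\mathrm{reg}}(H)$: using the natural order on $V(H)=[m]$, put $N^-(v)=\{w\in N_H(v): w<v\}$ and $N^{<u}(v)=\{w\in N_H(v): w<u\}$. Then $k_{\mathrm{reg}}(H)$ is the smallest number satisfying, for each $1\le i\le m$, both of the following. (A) For each $j\ge i$ with $ij\in E(H)$, $k_{\mathrm{reg}}(H)\ge\tfrac12|N^-(i)|+\tfrac12|N^{<i}(j)|+s$ for each value $s$ in the following list whose condition is met: $s=\tfrac32$ if there is $k>i$ with $jk\in E(H)$; $s=2$ if there is $k>i$ with $jk,ik\in E(H)$; $s=3$ if there is $k>i$ with $jk,ik\in E(H)$ and $|N^{<i}(k)|\le|N^{<i}(j)|$; $s=1$ if none of the preceding conditions is met. (B) For each $j,j'\ge i$ with $ij,jj'\in E(H)$, $k_{\mathrm{reg}}(H)\ge\tfrac12|N^{<i}(j)|+\tfrac12|N^{<i}(j')|+s'$, where $s'=2.501$ if $ij'\in E(H)$ and $s'=2.001$ otherwise. (If $H$ has no edges the value of $k_{\mathrm{reg}}(H)$ is irrelevant.) *)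

theory Defs
  imports Complex_Main "HOL-Library.FuncSet"
begin

record 'v ugraph =
  verts :: "'v set"
  edges :: "'v set set"

definition simple_graph :: "'v ugraph \<Rightarrow> bool" where
  "simple_graph G \<longleftrightarrow> finite (verts G) \<and> (\<forall>e\<in>edges G. e \<subseteq> verts G \<and> card e = 2)"

definition subgraph :: "'v ugraph \<Rightarrow> 'v ugraph \<Rightarrow> bool" where
  "subgraph G \<Gamma> \<longleftrightarrow> verts G \<subseteq> verts \<Gamma> \<and> edges G \<subseteq> edges \<Gamma>"

definition edges_between :: "'v ugraph \<Rightarrow> 'v set \<Rightarrow> 'v set \<Rightarrow> nat" where
  "edges_between G U W = card {e \<in> edges G. \<exists>u\<in>U. \<exists>w\<in>W. e = {u, w}}"

(* The two pair predicates below do not themselves require disjointness;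
   wherever they are used, disjointness is a separate hypothesis. *)
definition bijumbled :: "'v ugraph \<Rightarrow> real \<Rightarrow> real \<Rightarrow> 'v set \<Rightarrow> 'v set \<Rightarrow> bool" where
  "bijumbled \<Gamma> p \<gamma> U W \<longleftrightarrow>
    (\<forall>U' W'. U' \<subseteq> U \<and> W' \<subseteq> W \<longrightarrow>
      \<bar>real (edges_between \<Gamma> U' W') - p * real (card U') * real (card W')\<bar>
        \<le> \<gamma> * sqrt (real (card U') * real (card W')))"

(* For an empty set the value is 0, as division by 0 gives 0. If a set of a pair is
   empty, both sides of a counting inequality over that pair vanish. *)
definition p_density :: "'v ugraph \<Rightarrow> real \<Rightarrow> 'v set \<Rightarrow> 'v set \<Rightarrow> real" where
  "p_density G p U W =
    real (edges_between G U W) / (p * real (card U) * real (card W))"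

definition regular_pair :: "'v ugraph \<Rightarrow> real \<Rightarrow> real \<Rightarrow> 'v set \<Rightarrow> 'v set \<Rightarrow> bool" where
  "regular_pair G \<epsilon> p U W \<longleftrightarrow>
    (\<forall>U' W'. U' \<subseteq> U \<and> W' \<subseteq> W \<and>
        real (card U') \<ge> \<epsilon> * real (card U) \<and> real (card W') \<ge> \<epsilon> * real (card W) \<longrightarrow>
      \<bar>p_density G p U' W' - p_density G p U W\<bar> \<le> \<epsilon>)"

(* The maps need not be injective. *)
definition num_copies :: "nat ugraph \<Rightarrow> 'v ugraph \<Rightarrow> (nat \<Rightarrow> 'v set) \<Rightarrow> nat" where
  "num_copies H G V =
    card {\<phi> \<in> (\<Pi>\<^sub>E i\<in>verts H. V i). \<forall>i j. {i, j} \<in> edges H \<longrightarrow> {\<phi> i, \<phi> j} \<in> edges G}"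

definition graph_density :: "nat ugraph \<Rightarrow> 'v ugraph \<Rightarrow> real \<Rightarrow> (nat \<Rightarrow> 'v set) \<Rightarrow> real" where
  "graph_density H G p V =
    (\<Prod>(i, j) \<in> {(i, j). i < j \<and> {i, j} \<in> edges H}. p_density G p (V i) (V j))"

(* N^{<u}(v); in particular N^-(v) is nbrs_below H v v. *)
definition nbrs_below :: "nat ugraph \<Rightarrow> nat \<Rightarrow> nat \<Rightarrow> nat set" where
  "nbrs_below H u v = {w. {v, w} \<in> edges H \<and> w < u}"

definition condA1 :: "nat ugraph \<Rightarrow> nat \<Rightarrow> nat \<Rightarrow> bool" where
  "condA1 H i j \<longleftrightarrow> (\<exists>k>i. {j, k} \<in> edges H)"

definition condA2 :: "nat ugraph \<Rightarrow> nat \<Rightarrow> nat \<Rightarrow> bool" where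
  "condA2 H i j \<longleftrightarrow> (\<exists>k>i. {j, k} \<in> edges H \<and> {i, k} \<in> edges H)"

definition condA3 :: "nat ugraph \<Rightarrow> nat \<Rightarrow> nat \<Rightarrow> bool" where
  "condA3 H i j \<longleftrightarrow> (\<exists>k>i. {j, k} \<in> edges H \<and> {i, k} \<in> edges H \<and>
      card (nbrs_below H i k) \<le> card (nbrs_below H i j))"

definition A_values :: "nat ugraph \<Rightarrow> nat \<Rightarrow> nat \<Rightarrow> real set" where
  "A_values H i j = {s.
      s = 3/2 \<and> condA1 H i j \<or>
      s = 2 \<and> condA2 H i j \<or>
      s = 3 \<and> condA3 H i j \<or>
      s = 1 \<and> \<not> condA1 H i j \<and> \<not> condA2 H i j \<and> \<not> condA3 H i j}"

(* In the second part j' = i is allowed, as the range j' >= i says. *)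
definition k_reg_bound :: "nat ugraph \<Rightarrow> real \<Rightarrow> bool" where
  "k_reg_bound H k \<longleftrightarrow> (\<forall>i\<in>verts H.
      (\<forall>j\<in>verts H. j \<ge> i \<and> {i, j} \<in> edges H \<longrightarrow>
        (\<forall>s\<in>A_values H i j.
          k \<ge> real (card (nbrs_below H i i)) / 2 + real (card (nbrs_below H i j)) / 2 + s)) \<and>
      (\<forall>j\<in>verts H. \<forall>j'\<in>verts H. j \<ge> i \<and> j' \<ge> i \<and> {i, j} \<in> edges H \<and> {j, j'} \<in> edges H \<longrightarrow>
        k \<ge> real (card (nbrs_below H i j)) / 2 + real (card (nbrs_below H i j')) / 2
             + (if {i, j'} \<in> edges H then 2.501 else 2.001)))"

(* If H has an edge, k_reg_bound H is a nonempty finite system of lower bounds, so the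
   least element exists. If H has no edges, the value is unspecified. *)
definition k_reg :: "nat ugraph \<Rightarrow> real" where
  "k_reg H = (LEAST k. k_reg_bound H k)"

end

(* The vertices of H are embedded one at a time, in increasing order, keeping for every later vertex
   j a set of candidates of size comparable with p^a |V_j|, where a is the number of neighbours of j
   embedded so far. The copies are then counted by downward induction, provided that for all but few
   choices of the next vertex z the pairs of candidate sets stay regular when cut down to the
   neighbourhood of z.

   For this inheritance let f = 1_G - dp on X x Y, and suppose that for many z in Z there are sets
   X_z, Y_z of neighbours of z with a large sum of f over X_z x Y_z. With B(y,z) = [y in Y_z] and
   h(x,z) = sum_y f(x,y) B(y,z), Cauchy-Schwarz bounds sum_{xz in Gamma} |h| by sum_{xz in Gamma} h^2.
   Expanding the square over pairs y, y' and using that Gamma is jumbled on X x Z replaces the weight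
   [xz in Gamma] by p. If Y_z is an arbitrary subset of Y (z adjacent only to X), the remaining
   sum of h^2 over all x, z is small by regularity of f. If Y_z is a set of neighbours of z, that sum
   is sum_{y,y'} S(y,y') codeg_B(y,y') with S(y,y') = sum_x f(x,y) f(x,y'); here codeg_B is at most
   about p^2 |Z| for all but few pairs, and sum |S| is small by the first case, applied with Z = Y and
   B the sign pattern of S. *)

theory Submission
  imports Defs "HOL-Analysis.L2_Norm"

begin

section \<open>Jumbled relations\<close>

text \<open>The jumbledness bound is fixed in terms of the initial sizes, while a candidate set
  shrinks by a factor p for each embedded neighbour. The terms |N^{<i}|/2 in the exponent pay for
  exactly this mismatch. On top of it, inheritance consumes p^2 when z is adjacent to one side of a
  pair and p^3 when it is adjacent to both; the additional p buys the codegree estimate and the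
  higher precision needed when both sides shrink. A density may be 0, so no lower bound on candidate
  sets is available. Hence all errors are absolute, normalised by scales that bound the sizes only
  from above, and regularity becomes a cut-norm bound around the original density, which passes to
  subsets at no cost. This also allows exceptional vertices to be defined through neighbourhoods in
  Gamma, where jumbledness acts, although the candidates are neighbourhoods in G. Inheritance turns
  an error \<eta> into its square root (one side) or fourth root (both sides), so the error allowed
  before a step is chosen after the one allowed behind it.\<close>

definition jumbled :: "('a \<Rightarrow> 'b \<Rightarrow> bool) \<Rightarrow> real \<Rightarrow> real \<Rightarrow> 'a set \<Rightarrow> 'b set \<Rightarrow> bool" where
  "jumbled W p b X Y \<longleftrightarrow> (\<forall>X' Y'. X' \<subseteq> X \<longrightarrow> Y' \<subseteq> Y \<longrightarrow>
     \<bar>\<Sum>x\<in>X'. \<Sum>y\<in>Y'. of_bool (W x y) - p\<bar> \<le> b * sqrt (real (card X') * real (card Y')))"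

text \<open>This is the cut norm of f on the pair. The bound e is an absolute number, not relative
  to the subsets tested, and is therefore inherited by all subpairs.\<close>

definition cut_bounded :: "('a \<Rightarrow> 'b \<Rightarrow> real) \<Rightarrow> real \<Rightarrow> 'a set \<Rightarrow> 'b set \<Rightarrow> bool" where
  "cut_bounded f e X Y \<longleftrightarrow> (\<forall>X' Y'. X' \<subseteq> X \<longrightarrow> Y' \<subseteq> Y \<longrightarrow> \<bar>\<Sum>x\<in>X'. \<Sum>y\<in>Y'. f x y\<bar> \<le> e)"

lemma jumbledD:
  "jumbled W p b X Y \<Longrightarrow> X' \<subseteq> X \<Longrightarrow> Y' \<subseteq> Y \<Longrightarrow>
    \<bar>\<Sum>x\<in>X'. \<Sum>y\<in>Y'. of_bool (W x y) - p\<bar> \<le> b * sqrt (real (card X') * real (card Y'))"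
  unfolding jumbled_def by blast

lemma jumbled_subset: "jumbled W p b X Y \<Longrightarrow> X' \<subseteq> X \<Longrightarrow> Y' \<subseteq> Y \<Longrightarrow> jumbled W p b X' Y'"
  unfolding jumbled_def by (meson subset_trans)

lemma jumbled_swap: "jumbled W p b X Y \<Longrightarrow> jumbled (\<lambda>y x. W x y) p b Y X"
  unfolding jumbled_def by (subst sum.swap) (simp add: mult.commute)

lemma cut_boundedD:
  "cut_bounded f e X Y \<Longrightarrow> X' \<subseteq> X \<Longrightarrow> Y' \<subseteq> Y \<Longrightarrow> \<bar>\<Sum>x\<in>X'. \<Sum>y\<in>Y'. f x y\<bar> \<le> e"
  unfolding cut_bounded_def by blast

lemma cut_bounded_subset:
  "cut_bounded f e X Y \<Longrightarrow> X' \<subseteq> X \<Longrightarrow> Y' \<subseteq> Y \<Longrightarrow> cut_bounded f e X' Y'"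
  unfolding cut_bounded_def by (meson subset_trans)

lemma cut_bounded_swap: "cut_bounded f e X Y \<Longrightarrow> cut_bounded (\<lambda>y x. f x y) e Y X"
  unfolding cut_bounded_def by (subst sum.swap) simp

lemma cut_bounded_mono: "cut_bounded f e X Y \<Longrightarrow> e \<le> e' \<Longrightarrow> cut_bounded f e' X Y"
  unfolding cut_bounded_def by (meson order_trans)

section \<open>Cauchy-Schwarz and degree counts in jumbled pairs\<close>

lemma sum_mult_le_sqrt:
  fixes f g :: "'i \<Rightarrow> real"
  shows "(\<Sum>i\<in>A. f i * g i) \<le> sqrt (\<Sum>i\<in>A. (f i)\<^sup>2) * sqrt (\<Sum>i\<in>A. (g i)\<^sup>2)"
proof -
  have "(\<Sum>i\<in>A. f i * g i) \<le> (\<Sum>i\<in>A. \<bar>f i\<bar> * \<bar>g i\<bar>)"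
    by (rule sum_mono) (metis abs_ge_self abs_mult)
  also have "\<dots> \<le> L2_set f A * L2_set g A" by (rule L2_set_mult_ineq)
  finally show ?thesis unfolding L2_set_def .
qed

lemma real_card_filter: "finite A \<Longrightarrow> real (card {x\<in>A. P x}) = (\<Sum>x\<in>A. of_bool (P x))"
  by (simp add: sum.If_cases of_bool_def Int_def)

lemma sum_of_bool_filter:
  fixes g :: "'i \<Rightarrow> real"
  shows "finite A \<Longrightarrow> (\<Sum>x\<in>A. g x * of_bool (P x)) = (\<Sum>x\<in>{x\<in>A. P x}. g x)"
  by (rule sum.mono_neutral_cong_right) auto

text \<open>Jumbledness is tested on the set B of offending vertices against all of Y: each vertex
  has a surplus of at least \<open>p * mY\<close>, so \<open>n * p * mY\<close> is at most
  \<open>b * sqrt (n * card Y)\<close>, which is solved for n. The factor t measures how far b lies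
  below \<open>p * sqrt (mX * mY)\<close>, and the exceptional proportion is of order t
  squared.\<close>

lemma few_high_degree:
  assumes J: "jumbled W p b X Y" and fin: "finite X" "finite Y"
    and b: "b \<le> t * p * sqrt (mX * mY)"
    and p: "0 < p" and t: "0 \<le> t" and scales_nonneg: "0 \<le> mX" "0 \<le> mY"
    and Y: "real (card Y) \<le> K * mY" and K: "0 \<le> K"
  shows "real (card {x\<in>X. (K + 1) * p * mY < (\<Sum>y\<in>Y. of_bool (W x y))}) \<le> t\<^sup>2 * K * mX"
proof (cases "mY = 0")
  case True
  then have "Y = {}" using Y fin by simp
  then show ?thesis using True K scales_nonneg by simp
next
  case False
  then have mY: "mY > 0" using scales_nonneg by simp
  define B where "B = {x\<in>X. (K + 1) * p * mY < (\<Sum>y\<in>Y. of_bool (W x y))}"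
  define n where "n = real (card B)"
  have n0: "n \<ge> 0" by (simp add: n_def)
  have finB: "finite B" using fin by (simp add: B_def)
  have "n * (p * mY) = (\<Sum>x\<in>B. p * mY)" by (simp add: n_def)
  also have "\<dots> \<le> (\<Sum>x\<in>B. \<Sum>y\<in>Y. of_bool (W x y) - p)"
  proof (rule sum_mono)
    fix x assume "x \<in> B"
    then have "(K + 1) * p * mY < (\<Sum>y\<in>Y. of_bool (W x y))" by (simp add: B_def)
    moreover have "p * card Y \<le> p * (K * mY)" using Y p by (intro mult_left_mono) auto
    ultimately show "p * mY \<le> (\<Sum>y\<in>Y. of_bool (W x y) - p)"
      by (simp add: sum_subtractf algebra_simps)
  qed
  also have "\<dots> \<le> b * sqrt (n * card Y)"
    using jumbledD[OF J, of B Y] unfolding n_def B_def by auto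
  also have "\<dots> \<le> (t * p * sqrt (mX * mY)) * sqrt (n * (K * mY))"
    using b Y n0 t p scales_nonneg by (intro mult_mono real_sqrt_le_mono mult_left_mono mult_nonneg_nonneg) auto
  also have "\<dots> = (p * mY) * (t * sqrt (mX * n * K))"
  proof -
    have "sqrt (mX * mY) * sqrt (n * (K * mY)) = mY * sqrt (mX * n * K)"
      using mY by (simp add: real_sqrt_mult algebra_simps)
    then show ?thesis by (metis mult.assoc mult.left_commute)
  qed
  finally have "(p * mY) * n \<le> (p * mY) * (t * sqrt (mX * n * K))" by (simp add: mult.commute)
  then have "n \<le> t * sqrt (mX * n * K)" using p mY by simp
  then have "n\<^sup>2 \<le> (t * sqrt (mX * n * K))\<^sup>2" using n0 by (intro power_mono) auto
  also have "\<dots> = n * (t\<^sup>2 * K * mX)"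
    using scales_nonneg n0 K by (simp add: power_mult_distrib)
  finally have "n * n \<le> n * (t\<^sup>2 * K * mX)" by (simp add: power2_eq_square)
  then have "n \<le> t\<^sup>2 * K * mX" using n0 scales_nonneg K by (cases "n = 0") auto
  then show ?thesis unfolding n_def B_def .
qed

text \<open>The scales \<open>mX\<close> and \<open>mY\<close> stand in for the sizes in every error
  term. They bound the sizes from above up to K, so small and empty sets need no separate treatment
  in the estimates.\<close>

locale sparse_pair =
  fixes X :: "'a set" and Y :: "'b set" and W :: "'a \<Rightarrow> 'b \<Rightarrow> bool" and p K mX mY b :: real
  assumes fin: "finite X" "finite Y" and p: "0 < p" "p \<le> 1" and K: "1 \<le> K"
    and cX: "real (card X) \<le> K * mX" and cY: "real (card Y) \<le> K * mY"
    and J: "jumbled W p b X Y"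
begin

lemma scales_nonneg: "0 \<le> mX" "0 \<le> mY"
proof -
  have "0 \<le> K * mX" "0 \<le> K * mY" using cX cY by linarith+
  then show "0 \<le> mX" "0 \<le> mY" using K by (auto simp: zero_le_mult_iff)
qed

lemma sum_degrees_le:
  assumes b: "b \<le> p * sqrt (mX * mY)"
  shows "(\<Sum>x\<in>X. \<Sum>y\<in>Y. of_bool (W x y)) \<le> 2 * K\<^sup>2 * p * mX * mY"
proof -
  have cc: "real (card X) * real (card Y) \<le> (K * mX) * (K * mY)"
    using cX cY K scales_nonneg by (intro mult_mono) auto
  have "(\<Sum>x\<in>X. \<Sum>y\<in>Y. of_bool (W x y)) - p * (real (card X) * real (card Y))
      \<le> b * sqrt (real (card X) * real (card Y))"
    using jumbledD[OF J, of X Y] by (simp add: sum_subtractf algebra_simps)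
  also have "\<dots> \<le> (p * sqrt (mX * mY)) * sqrt ((K * mX) * (K * mY))"
    using b real_sqrt_le_mono[OF cc] p scales_nonneg by (intro mult_mono) auto
  also have "\<dots> = p * K * mX * mY"
  proof -
    have "sqrt ((K * mX) * (K * mY)) = K * sqrt (mX * mY)"
      using K by (simp add: real_sqrt_mult)
    then show ?thesis using scales_nonneg by simp
  qed
  also have "\<dots> \<le> p * K\<^sup>2 * mX * mY"
    using K p scales_nonneg by (intro mult_right_mono mult_left_mono) (auto simp: power2_eq_square)
  finally have "(\<Sum>x\<in>X. \<Sum>y\<in>Y. of_bool (W x y)) \<le> p * (real (card X) * real (card Y)) + p * K\<^sup>2 * mX * mY"
    by simp
  also have "p * (real (card X) * real (card Y)) \<le> p * ((K * mX) * (K * mY))"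
    using cc p by simp
  finally show ?thesis by (simp add: power2_eq_square algebra_simps)
qed

text \<open>The factor \<open>p * p\<close> in the bound on b gives \<open>few_high_degree\<close>
  with t = p: all but a proportion of order p^2 of the vertices have degree of order
  \<open>p * mY\<close>, and on the rest the trivial bound \<open>K * mY\<close> contributes the
  same order p^2.\<close>

lemma sum_degrees_squared_le:
  assumes b: "b \<le> p * p * sqrt (mX * mY)"
  shows "(\<Sum>x\<in>X. (\<Sum>y\<in>Y. of_bool (W x y))\<^sup>2) \<le> 5 * K ^ 3 * p\<^sup>2 * mX * mY\<^sup>2"
proof -
  define D where "D x = (\<Sum>y\<in>Y. of_bool (W x y) :: real)" for x
  define B where "B = {x\<in>X. (K + 1) * p * mY < D x}"
  have D0: "0 \<le> D x" for x unfolding D_def by (intro sum_nonneg) auto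
  have DY: "D x \<le> K * mY" for x
  proof -
    have "D x \<le> (\<Sum>y\<in>Y. 1)" unfolding D_def by (intro sum_mono) auto
    then show ?thesis using cY by simp
  qed
  have cB: "real (card B) \<le> p\<^sup>2 * K * mX"
    unfolding B_def D_def using few_high_degree[OF J fin b, of K] p scales_nonneg cY K by simp
  have "(\<Sum>x\<in>X. (D x)\<^sup>2) \<le> (\<Sum>x\<in>X. ((K + 1) * p * mY)\<^sup>2 + of_bool (x \<in> B) * (K * mY)\<^sup>2)"
  proof (rule sum_mono)
    fix x assume x: "x \<in> X"
    show "(D x)\<^sup>2 \<le> ((K + 1) * p * mY)\<^sup>2 + of_bool (x \<in> B) * (K * mY)\<^sup>2"
    proof (cases "x \<in> B")
      case True
      have "(D x)\<^sup>2 \<le> (K * mY)\<^sup>2" using DY D0 by (intro power_mono) auto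
      then show ?thesis using True by (simp add: add_increasing)
    next
      case False
      then have "D x \<le> (K + 1) * p * mY" using x by (auto simp: B_def)
      then have "(D x)\<^sup>2 \<le> ((K + 1) * p * mY)\<^sup>2" using D0 by (intro power_mono) auto
      then show ?thesis using False by simp
    qed
  qed
  also have "\<dots> = card X * ((K + 1) * p * mY)\<^sup>2 + card B * (K * mY)\<^sup>2"
  proof -
    have "real (card B) = (\<Sum>x\<in>X. of_bool (x \<in> B))"
      using fin by (subst real_card_filter[symmetric]) (auto simp: B_def intro: arg_cong[where f=card])
    then show ?thesis by (simp add: sum.distrib sum_distrib_right)
  qed
  \<comment> \<open>Here \<open>K + 1 \<le> 2 * K\<close>, so the typical vertices contribute 4 and
    the exceptional ones 1 to the constant 5.\<close>
  also have "\<dots> \<le> (K * mX) * (2 * K * p * mY)\<^sup>2 + (p\<^sup>2 * K * mX) * (K * mY)\<^sup>2"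
    using cX cB K p scales_nonneg by (intro add_mono mult_mono power_mono mult_right_mono) auto
  also have "\<dots> = 5 * K ^ 3 * p\<^sup>2 * mX * mY\<^sup>2"
    by (simp add: power_mult_distrib power2_eq_square power3_eq_cube)
  finally show ?thesis unfolding D_def .
qed

end

text \<open>Splitting X by the sign of the row sum turns each half into a single test of the cut
  bound, hence the factor 2.\<close>

lemma sum_abs_rows_le:
  fixes f :: "'a \<Rightarrow> 'b \<Rightarrow> real"
  assumes "cut_bounded f e X Y" "finite X" "finite Y"
  shows "(\<Sum>x\<in>X. \<bar>\<Sum>y\<in>Y. f x y * of_bool (B y)\<bar>) \<le> 2 * e"
proof -
  define h where "h x = (\<Sum>y\<in>{y\<in>Y. B y}. f x y)" for x
  have h: "(\<Sum>y\<in>Y. f x y * of_bool (B y)) = h x" for x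
    unfolding h_def using assms by (simp only: sum_of_bool_filter)
  have "(\<Sum>x\<in>X. \<bar>h x\<bar>) = (\<Sum>x\<in>{x\<in>X. 0 \<le> h x}. h x) - (\<Sum>x\<in>{x\<in>X. h x < 0}. h x)"
    using assms by (subst (1 2) sum.inter_filter) (auto simp: sum_subtractf[symmetric] intro!: sum.cong)
  also have "\<dots> \<le> 2 * e"
    using cut_boundedD[OF assms(1), of "{x\<in>X. 0 \<le> h x}" "{y\<in>Y. B y}"]
      cut_boundedD[OF assms(1), of "{x\<in>X. h x < 0}" "{y\<in>Y. B y}"]
    unfolding h_def by auto
  finally show ?thesis by (simp add: h)
qed

text \<open>Each s gives one rectangle, on which jumbledness applies; Cauchy-Schwarz over s then
  combines the square roots of the side lengths. This is the device for replacing the indicator of W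
  by p in sums over pairs.\<close>

lemma jumbled_family:
  assumes J: "jumbled W p b X Z" and fin: "finite X" "finite Z" and b: "0 \<le> b"
  shows "\<bar>\<Sum>s\<in>I. \<Sum>x\<in>X. \<Sum>z\<in>Z. (of_bool (W x z) - p) * (of_bool (a s x) * of_bool (c s z))\<bar>
    \<le> b * (sqrt (\<Sum>s\<in>I. \<Sum>x\<in>X. of_bool (a s x)) * sqrt (\<Sum>s\<in>I. \<Sum>z\<in>Z. of_bool (c s z)))"
proof -
  define A where "A s = {x\<in>X. a s x}" for s
  define C where "C s = {z\<in>Z. c s z}" for s
  have eq: "(\<Sum>x\<in>X. \<Sum>z\<in>Z. (of_bool (W x z) - p) * (of_bool (a s x) * of_bool (c s z)))
    = (\<Sum>x\<in>A s. \<Sum>z\<in>C s. of_bool (W x z) - p)" for s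
    unfolding A_def C_def using fin
    by (simp only: sum_of_bool_filter[symmetric] sum_distrib_right mult.assoc)
      (simp only: mult.commute mult.left_commute)
  have "\<bar>\<Sum>s\<in>I. \<Sum>x\<in>X. \<Sum>z\<in>Z. (of_bool (W x z) - p) * (of_bool (a s x) * of_bool (c s z))\<bar>
    \<le> (\<Sum>s\<in>I. b * (sqrt (card (A s)) * sqrt (card (C s))))"
    unfolding eq
  proof (rule order_trans[OF sum_abs sum_mono])
    fix s
    show "\<bar>\<Sum>x\<in>A s. \<Sum>z\<in>C s. of_bool (W x z) - p\<bar> \<le> b * (sqrt (card (A s)) * sqrt (card (C s)))"
      using jumbledD[OF J, of "A s" "C s"] unfolding A_def C_def by (auto simp: real_sqrt_mult)
  qed
  also have "\<dots> = b * (\<Sum>s\<in>I. sqrt (card (A s)) * sqrt (card (C s)))"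
    by (simp add: sum_distrib_left)
  also have "\<dots> \<le> b * (sqrt (\<Sum>s\<in>I. (sqrt (card (A s)))\<^sup>2) * sqrt (\<Sum>s\<in>I. (sqrt (card (C s)))\<^sup>2))"
    by (intro mult_left_mono sum_mult_le_sqrt b)
  also have "\<dots> = b * (sqrt (\<Sum>s\<in>I. \<Sum>x\<in>X. of_bool (a s x)) * sqrt (\<Sum>s\<in>I. \<Sum>z\<in>Z. of_bool (c s z)))"
    unfolding A_def C_def using fin by (simp add: real_card_filter)
  finally show ?thesis .
qed

section \<open>Regularity inheritance\<close>

lemma sum_triple_swap:
  fixes g :: "'s \<Rightarrow> 'a \<Rightarrow> 'c \<Rightarrow> real"
  shows "(\<Sum>s\<in>I. \<Sum>x\<in>X. \<Sum>z\<in>Z. g s x z) = (\<Sum>x\<in>X. \<Sum>z\<in>Z. \<Sum>s\<in>I. g s x z)"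
  by (subst sum.swap, rule sum.cong[OF refl], rule sum.swap)

text \<open>Cauchy-Schwarz over the pairs (x, z). The 0/1 weight equals its own square, so it
  survives in both factors.\<close>

lemma sum_weighted_abs_le:
  fixes h :: "'a \<Rightarrow> 'c \<Rightarrow> real"
  shows "(\<Sum>x\<in>X. \<Sum>z\<in>Z. of_bool (P x z) * \<bar>h x z\<bar>)
    \<le> sqrt (\<Sum>x\<in>X. \<Sum>z\<in>Z. of_bool (P x z)) * sqrt (\<Sum>x\<in>X. \<Sum>z\<in>Z. of_bool (P x z) * (h x z)\<^sup>2)"
proof -
  define a where "a q = (of_bool (P (fst q) (snd q)) :: real)" for q
  define H where "H q = h (fst q) (snd q)" for q
  have "(\<Sum>q\<in>X \<times> Z. a q * (a q * \<bar>H q\<bar>))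
    \<le> sqrt (\<Sum>q\<in>X \<times> Z. (a q)\<^sup>2) * sqrt (\<Sum>q\<in>X \<times> Z. (a q * \<bar>H q\<bar>)\<^sup>2)"
    by (rule sum_mult_le_sqrt)
  moreover have "a q * (a q * \<bar>H q\<bar>) = a q * \<bar>H q\<bar>" "(a q)\<^sup>2 = a q"
    "(a q * \<bar>H q\<bar>)\<^sup>2 = a q * (H q)\<^sup>2" for q
    by (simp_all add: a_def)
  ultimately have "(\<Sum>q\<in>X \<times> Z. a q * \<bar>H q\<bar>)
    \<le> sqrt (\<Sum>q\<in>X \<times> Z. a q) * sqrt (\<Sum>q\<in>X \<times> Z. a q * (H q)\<^sup>2)"
    by (simp only:)
  then show ?thesis
    unfolding sum.cartesian_product' a_def H_def fst_conv snd_conv .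
qed

text \<open>E plays the role of G and W that of Gamma. One parameter \<open>\<eta>\<close> governs
  both regularity and jumbledness; the surplus \<open>\<eta> * p\<close> in the bound on b makes
  vertices of high W-degree a proportion of order \<open>(\<eta> * p)\<^sup>2\<close>.\<close>

locale regular_sparse_pair = sparse_pair X Y W p K mX mY b
  for X :: "'a set" and Y :: "'b set" and W p K mX mY b +
  fixes E :: "'a \<Rightarrow> 'b \<Rightarrow> bool" and \<delta> \<eta> :: real
  assumes EW: "\<And>x y. E x y \<Longrightarrow> W x y" and \<delta>: "0 \<le> \<delta>" "\<delta> \<le> 2" and \<eta>: "0 \<le> \<eta>" "\<eta> \<le> 1"
    and b: "b \<le> \<eta> * p * p * sqrt (mX * mY)"
    and R: "cut_bounded (\<lambda>x y. of_bool (E x y) - \<delta> * p) (\<eta> * p * mX * mY) X Y"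
begin

abbreviation f :: "'a \<Rightarrow> 'b \<Rightarrow> real" where "f x y \<equiv> of_bool (E x y) - \<delta> * p"

lemma \<delta>p_bounds: "0 \<le> \<delta> * p" "\<delta> * p \<le> 2 * p" "\<delta> * p \<le> 2"
  using \<delta> p mult_mono[of \<delta> 2 p 1] by auto

lemma b_le: "b \<le> p * p * sqrt (mX * mY)" "b \<le> p * sqrt (mX * mY)"
proof -
  have "\<eta> * (p * p * sqrt (mX * mY)) \<le> 1 * (p * p * sqrt (mX * mY))"
    using \<eta> p scales_nonneg by (intro mult_right_mono) auto
  then show "b \<le> p * p * sqrt (mX * mY)" using b by (simp add: mult.assoc)
  also have "\<dots> \<le> 1 * p * sqrt (mX * mY)" using p scales_nonneg by (intro mult_right_mono) auto
  finally show "b \<le> p * sqrt (mX * mY)" by simp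
qed

lemma f_le: "\<bar>f x y\<bar> \<le> of_bool (W x y) + 2 * p" "\<bar>f x y\<bar> \<le> 2"
proof -
  have *: "\<bar>of_bool e - q\<bar> \<le> of_bool w + 2 * p" "\<bar>of_bool e - q\<bar> \<le> 2"
    if "0 \<le> q" "q \<le> 2 * p" "q \<le> 2" "e \<longrightarrow> w" for q and e w :: bool
    using that p by (cases e; cases w; simp)+
  show "\<bar>f x y\<bar> \<le> of_bool (W x y) + 2 * p" "\<bar>f x y\<bar> \<le> 2"
    using *[OF \<delta>p_bounds, of "E x y" "W x y"] EW by simp_all
qed

text \<open>Since f is dominated by W plus 2p, a row sum is at most \<open>4 * K * p * mY\<close> in
  absolute value unless x has high degree. One factor of the square is bounded in this way, and the
  other is summed by the cut bound. The few rows of high degree are estimated trivially.\<close>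

lemma sum_rows_squared_le:
  "(\<Sum>x\<in>X. (\<Sum>y\<in>Y. f x y * of_bool (B y))\<^sup>2) \<le> 12 * K ^ 3 * \<eta> * p\<^sup>2 * mX * mY\<^sup>2"
proof -
  define h where "h x = (\<Sum>y\<in>Y. f x y * of_bool (B y))" for x
  define D where "D x = (\<Sum>y\<in>Y. of_bool (W x y) :: real)" for x
  define T where "T = {x\<in>X. (K + 1) * p * mY < D x}"
  have hD: "\<bar>h x\<bar> \<le> D x + 2 * p * (K * mY)" for x
  proof -
    have "\<bar>h x\<bar> \<le> (\<Sum>y\<in>Y. of_bool (W x y) + 2 * p)"
      unfolding h_def
    proof (rule order_trans[OF sum_abs sum_mono])
      show "\<bar>f x y * of_bool (B y)\<bar> \<le> of_bool (W x y) + 2 * p" for y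
        using f_le(1)[of x y] p by (cases "B y") auto
    qed
    also have "\<dots> = D x + 2 * p * card Y" by (simp add: D_def sum.distrib)
    also have "\<dots> \<le> D x + 2 * p * (K * mY)" using cY p by (intro add_left_mono mult_left_mono) auto
    finally show ?thesis .
  qed
  have h2: "\<bar>h x\<bar> \<le> 2 * K * mY" for x
  proof -
    have "\<bar>h x\<bar> \<le> (\<Sum>y\<in>Y. 2)"
      unfolding h_def
    proof (rule order_trans[OF sum_abs sum_mono])
      show "\<bar>f x y * of_bool (B y)\<bar> \<le> 2" for y
        using f_le(2)[of x y] by (cases "B y") auto
    qed
    then show ?thesis using cY by simp
  qed
  have cT: "real (card T) \<le> (\<eta> * p)\<^sup>2 * K * mX"
    unfolding T_def D_def using b p scales_nonneg cY K \<eta> by (intro few_high_degree[OF J fin]) auto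
  have "(\<Sum>x\<in>X. (h x)\<^sup>2) \<le> (\<Sum>x\<in>X. 4 * K * p * mY * \<bar>h x\<bar> + of_bool (x \<in> T) * (2 * K * mY)\<^sup>2)"
  proof (rule sum_mono)
    fix x assume x: "x \<in> X"
    show "(h x)\<^sup>2 \<le> 4 * K * p * mY * \<bar>h x\<bar> + of_bool (x \<in> T) * (2 * K * mY)\<^sup>2"
    proof (cases "x \<in> T")
      case True
      have "(h x)\<^sup>2 \<le> (2 * K * mY)\<^sup>2" using power_mono[OF h2, of x 2] by simp
      moreover have "0 \<le> 4 * K * p * mY * \<bar>h x\<bar>" using K p scales_nonneg by simp
      ultimately have "(h x)\<^sup>2 \<le> 4 * K * p * mY * \<bar>h x\<bar> + (2 * K * mY)\<^sup>2" by linarith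
      then show ?thesis using True by simp
    next
      case False
      then have "D x \<le> (K + 1) * p * mY" using x by (auto simp: T_def)
      then have "\<bar>h x\<bar> \<le> (K + 1) * p * mY + 2 * p * (K * mY)" using hD[of x] by linarith
      also have "\<dots> = (3 * K + 1) * (p * mY)" by (simp add: algebra_simps)
      also have "\<dots> \<le> (4 * K) * (p * mY)" using K p scales_nonneg by (intro mult_right_mono) auto
      finally have "\<bar>h x\<bar> * \<bar>h x\<bar> \<le> (4 * K * p * mY) * \<bar>h x\<bar>"
        by (intro mult_right_mono) (auto simp: mult.assoc)
      then show ?thesis using False by (simp add: power2_eq_square)
    qed
  qed
  also have "\<dots> = 4 * K * p * mY * (\<Sum>x\<in>X. \<bar>h x\<bar>) + card T * (2 * K * mY)\<^sup>2"
  proof -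
    have "real (card T) = (\<Sum>x\<in>X. of_bool (x \<in> T))"
      using fin by (subst real_card_filter[symmetric]) (auto simp: T_def intro: arg_cong[where f=card])
    then show ?thesis by (simp add: sum.distrib sum_distrib_right sum_distrib_left)
  qed
  also have "\<dots> \<le> 4 * K * p * mY * (2 * (\<eta> * p * mX * mY)) + ((\<eta> * p)\<^sup>2 * K * mX) * (2 * K * mY)\<^sup>2"
    using sum_abs_rows_le[OF R fin, of B] cT K p scales_nonneg unfolding h_def
    by (intro add_mono mult_left_mono mult_right_mono) auto
  also have "\<dots> = 8 * K * (\<eta> * p\<^sup>2 * mX * mY\<^sup>2) + 4 * K ^ 3 * (\<eta> * (\<eta> * p\<^sup>2 * mX * mY\<^sup>2))"
    by (simp add: power_mult_distrib power2_eq_square power3_eq_cube)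
  also have "\<dots> \<le> 8 * K ^ 3 * (\<eta> * p\<^sup>2 * mX * mY\<^sup>2) + 4 * K ^ 3 * (1 * (\<eta> * p\<^sup>2 * mX * mY\<^sup>2))"
    using K \<eta> p scales_nonneg self_le_power[of K 3] by (intro add_mono mult_mono) auto
  finally show ?thesis unfolding h_def by (simp add: mult_ac)
qed

text \<open>The four indicator terms arise because f is signed, whereas jumbledness speaks of sets.
  The sum of squared column sizes of B is left unevaluated in the error term: it is smaller by a
  factor of order p^2 when B lies in a jumbled relation.\<close>

lemma sum_weighted_squares_le:
  fixes Z :: "'c set" and B :: "'b \<Rightarrow> 'c \<Rightarrow> bool"
  assumes finZ: "finite Z" and J': "jumbled W' p b' X Z" and b': "0 \<le> b'"
  defines "h \<equiv> \<lambda>x z. \<Sum>y\<in>Y. f x y * of_bool (B y z)"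
  shows "(\<Sum>x\<in>X. \<Sum>z\<in>Z. of_bool (W' x z) * (h x z)\<^sup>2)
    \<le> p * (\<Sum>x\<in>X. \<Sum>z\<in>Z. (h x z)\<^sup>2)
      + 15 * K\<^sup>2 * p * b' * sqrt (\<Sum>z\<in>Z. (\<Sum>y\<in>Y. of_bool (B y z))\<^sup>2) * sqrt mX * mY"
proof -
  define r where "r = sqrt (\<Sum>z\<in>Z. (\<Sum>y\<in>Y. of_bool (B y z) :: real)\<^sup>2)"
  define I where "I = Y \<times> Y"
  (* h^2 is a combination of four sums over pairs s = (y, y') of products of an indicator in x
     (the cases a1, ..., a4) and the indicator c in z, to each of which jumbledness applies. *)
  define c where "c s z \<longleftrightarrow> B (fst s) z \<and> B (snd s) z" for s z
  define N where "N a = (\<Sum>s\<in>I. \<Sum>x\<in>X. of_bool (a s x :: bool) :: real)" for a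
  define wt where "wt x z = of_bool (W' x z) - p" for x z
  define T where "T a = (\<Sum>s\<in>I. \<Sum>x\<in>X. \<Sum>z\<in>Z. wt x z * (of_bool (a s x) * of_bool (c s z)))" for a
  define a1 where "a1 s x \<longleftrightarrow> E x (fst s) \<and> E x (snd s)" for s x
  define a2 where "a2 s x \<longleftrightarrow> E x (fst s)" for s :: "'b \<times> 'b" and x
  define a3 where "a3 s x \<longleftrightarrow> E x (snd s)" for s :: "'b \<times> 'b" and x
  define a4 where "a4 s x \<longleftrightarrow> True" for s :: "'b \<times> 'b" and x :: 'a
  define Q where "Q = K\<^sup>2 * sqrt mX * mY"
  have Q0: "0 \<le> Q" unfolding Q_def using K scales_nonneg by simp
  have prod_I: "(\<Sum>y\<in>Y. u y) * (\<Sum>y\<in>Y. v y) = (\<Sum>s\<in>I. u (fst s) * v (snd s))" for u v :: "'b \<Rightarrow> real"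
    unfolding I_def sum_product sum.cartesian_product' by simp
  have r2: "(\<Sum>s\<in>I. \<Sum>z\<in>Z. of_bool (c s z)) = (\<Sum>z\<in>Z. (\<Sum>y\<in>Y. of_bool (B y z) :: real)\<^sup>2)"
    unfolding c_def by (subst sum.swap) (simp add: power2_eq_square prod_I of_bool_conj)
  have T_le: "\<bar>T a\<bar> \<le> b' * (sqrt (N a) * r)" for a
    unfolding T_def N_def r_def wt_def r2[symmetric]
    using jumbled_family[OF J' fin(1) finZ b'] .
  have T_eq: "T a = (\<Sum>x\<in>X. \<Sum>z\<in>Z. wt x z * (\<Sum>s\<in>I. of_bool (a s x) * of_bool (c s z)))" for a
    unfolding T_def by (subst sum_triple_swap) (simp only: sum_distrib_left)
  define P where "P a x z = (\<Sum>s\<in>I. of_bool (a s x) * of_bool (c s z) :: real)"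
    for a :: "'b \<times> 'b \<Rightarrow> 'a \<Rightarrow> bool" and x z
  have h2: "(h x z)\<^sup>2 = P a1 x z - \<delta> * p * P a2 x z - \<delta> * p * P a3 x z + (\<delta> * p)\<^sup>2 * P a4 x z" for x z
  proof -
    define G where "G = (\<Sum>y\<in>Y. of_bool (E x y) * of_bool (B y z) :: real)"
    define D where "D = (\<Sum>y\<in>Y. of_bool (B y z) :: real)"
    have hz: "h x z = G - \<delta> * p * D"
      unfolding h_def G_def D_def by (simp add: left_diff_distrib sum_subtractf sum_distrib_left)
    have "(h x z)\<^sup>2 = G * G - \<delta> * p * (G * D) - \<delta> * p * (D * G) + (\<delta> * p)\<^sup>2 * (D * D)"
      unfolding hz by (simp add: power2_eq_square algebra_simps)
    then show ?thesis
      unfolding G_def D_def prod_I P_def a1_def a2_def a3_def a4_def c_def of_bool_conj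
      by (simp only: mult_ac of_bool_eq mult_1_left mult_1_right)
  qed
  have wt_h2: "wt x z * (h x z)\<^sup>2 = wt x z * P a1 x z - \<delta> * p * (wt x z * P a2 x z)
      - \<delta> * p * (wt x z * P a3 x z) + (\<delta> * p)\<^sup>2 * (wt x z * P a4 x z)" for x z
    unfolding h2 by (simp add: algebra_simps)
  have "(\<Sum>x\<in>X. \<Sum>z\<in>Z. wt x z * (h x z)\<^sup>2) = T a1 - \<delta> * p * T a2 - \<delta> * p * T a3 + (\<delta> * p)\<^sup>2 * T a4"
    unfolding T_eq wt_h2 P_def[symmetric]
    by (simp only: sum.distrib sum_subtractf sum_distrib_left)
  \<comment> \<open>The error needs a factor p. For \<open>a1\<close> it comes from the squared
    degrees, giving 3; for the other three terms it comes from the coefficients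
    \<open>\<delta> * p \<le> 2 * p\<close>, giving 4 each.\<close>
  also have "\<dots> \<le> 15 * p * (b' * (Q * r))"
  proof -
    have r0: "0 \<le> r" unfolding r_def by (intro real_sqrt_ge_zero sum_nonneg) auto
    have T_bound: "\<bar>T a\<bar> \<le> t * (b' * (Q * r))" if "N a \<le> (t * Q)\<^sup>2" "0 \<le> t" for a t
    proof -
      have "sqrt (N a) \<le> t * Q" using that Q0 by (intro real_le_lsqrt) auto
      then have "b' * (sqrt (N a) * r) \<le> b' * ((t * Q) * r)"
        using b' r0 by (intro mult_left_mono mult_right_mono) auto
      then show ?thesis using T_le[of a] by (simp add: mult_ac)
    qed
    have Q2: "(t * Q)\<^sup>2 = t\<^sup>2 * (K ^ 4 * mX * mY\<^sup>2)" for t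
      unfolding Q_def using scales_nonneg by (simp add: power_mult_distrib)
    have K3: "K ^ 3 \<le> K ^ 4" using K by (intro power_increasing) auto
    have degE: "(\<Sum>y\<in>Y. of_bool (E x y) :: real) \<le> (\<Sum>y\<in>Y. of_bool (W x y))" for x
      using EW by (intro sum_mono) (auto simp: of_bool_def)
    have N1: "N a1 \<le> (3 * p * Q)\<^sup>2"
    proof -
      have "N a1 = (\<Sum>x\<in>X. (\<Sum>y\<in>Y. of_bool (E x y) :: real)\<^sup>2)"
        unfolding N_def a1_def by (subst sum.swap) (simp add: power2_eq_square prod_I of_bool_conj)
      also have "\<dots> \<le> (\<Sum>x\<in>X. (\<Sum>y\<in>Y. of_bool (W x y))\<^sup>2)"
        by (intro sum_mono power_mono degE sum_nonneg) auto
      also have "\<dots> \<le> 5 * K ^ 3 * p\<^sup>2 * mX * mY\<^sup>2" by (rule sum_degrees_squared_le[OF b_le(1)])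
      also have "\<dots> \<le> 9 * K ^ 4 * p\<^sup>2 * mX * mY\<^sup>2"
        using K3 K scales_nonneg p by (intro mult_right_mono mult_mono) auto
      finally show ?thesis unfolding Q2 by (simp add: power_mult_distrib mult_ac)
    qed
    have N23: "N a \<le> (2 * Q)\<^sup>2" if "N a = card Y * (\<Sum>x\<in>X. \<Sum>y\<in>Y. of_bool (E x y) :: real)" for a
    proof -
      have "(\<Sum>x\<in>X. \<Sum>y\<in>Y. of_bool (E x y) :: real) \<le> (\<Sum>x\<in>X. \<Sum>y\<in>Y. of_bool (W x y))"
        by (intro sum_mono degE)
      also have "\<dots> \<le> 2 * K\<^sup>2 * p * mX * mY" by (rule sum_degrees_le[OF b_le(2)])
      also have "\<dots> \<le> 2 * K\<^sup>2 * 1 * mX * mY" using p K scales_nonneg by (intro mult_right_mono mult_left_mono) auto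
      finally have "N a \<le> (K * mY) * (2 * K\<^sup>2 * 1 * mX * mY)"
        unfolding that using cY K scales_nonneg by (intro mult_mono sum_nonneg) auto
      also have "\<dots> = 2 * K ^ 3 * mX * mY\<^sup>2" by (simp add: power2_eq_square power3_eq_cube)
      also have "\<dots> \<le> 4 * K ^ 4 * mX * mY\<^sup>2"
        using K3 K scales_nonneg by (intro mult_right_mono mult_mono) auto
      finally show ?thesis unfolding Q2 by (simp add: mult_ac)
    qed
    have sw: "(\<Sum>y\<in>Y. \<Sum>x\<in>X. of_bool (E x y) :: real) = (\<Sum>x\<in>X. \<Sum>y\<in>Y. of_bool (E x y))"
      by (rule sum.swap)
    have N_Y: "N a = (\<Sum>y\<in>Y. \<Sum>y'\<in>Y. \<Sum>x\<in>X. of_bool (a (y, y') x))" for a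
      unfolding N_def I_def by (simp only: sum.cartesian_product')
    have "N a2 = card Y * (\<Sum>y\<in>Y. \<Sum>x\<in>X. of_bool (E x y) :: real)"
      unfolding N_Y a2_def fst_conv by (simp only: sum_constant sum_distrib_left)
    then have N2: "N a2 \<le> (2 * Q)\<^sup>2" unfolding sw by (rule N23)
    have "N a3 = card Y * (\<Sum>y\<in>Y. \<Sum>x\<in>X. of_bool (E x y) :: real)"
      unfolding N_Y a3_def snd_conv by (simp only: sum_constant)
    then have N3: "N a3 \<le> (2 * Q)\<^sup>2" unfolding sw by (rule N23)
    have N4: "N a4 \<le> (1 * Q)\<^sup>2"
    proof -
      have "N a4 = real (card Y) * real (card Y) * real (card X)"
        unfolding N_def a4_def I_def by (simp add: card_cartesian_product)
      also have "\<dots> \<le> (K * mY) * (K * mY) * (K * mX)"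
        using cX cY K scales_nonneg by (intro mult_mono) auto
      also have "\<dots> = K ^ 3 * mX * mY\<^sup>2" by (simp add: power2_eq_square power3_eq_cube)
      also have "\<dots> \<le> K ^ 4 * mX * mY\<^sup>2" using K3 scales_nonneg by (intro mult_right_mono) auto
      finally show ?thesis unfolding Q2 by simp
    qed
    define V where "V = b' * (Q * r)"
    have V0: "0 \<le> V" unfolding V_def using b' Q0 r0 by simp
    have t1: "T a1 \<le> 3 * p * V" using T_bound[OF N1] p unfolding V_def by auto
    have t23: "- (\<delta> * p * T a) \<le> 4 * p * V" if "N a \<le> (2 * Q)\<^sup>2" for a
    proof -
      have "- (\<delta> * p * T a) \<le> \<delta> * p * \<bar>T a\<bar>" 
        using mult_left_mono[OF abs_ge_minus_self[of "T a"] \<delta>p_bounds(1)] by simp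
      also have "\<dots> \<le> (2 * p) * (2 * V)"
        using T_bound[OF that] \<delta>p_bounds p V0 unfolding V_def by (intro mult_mono) auto
      finally show ?thesis by simp
    qed
    have t4: "(\<delta> * p)\<^sup>2 * T a4 \<le> 4 * p * V"
    proof -
      have "(\<delta> * p)\<^sup>2 * T a4 \<le> (\<delta> * p)\<^sup>2 * V"
        using T_bound[OF N4] unfolding V_def by (intro mult_left_mono) auto
      also have "\<dots> \<le> (2 * (2 * p)) * V"
        using \<delta> \<delta>p_bounds V0 unfolding power2_eq_square by (intro mult_right_mono mult_mono) auto
      finally show ?thesis by simp
    qed
    have "15 * p * (b' * (Q * r)) = 3 * p * V + 4 * p * V + 4 * p * V + 4 * p * V"
      unfolding V_def by simp
    then show ?thesis using t1 t23[OF N2] t23[OF N3] t4 by linarith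
  qed
  finally have "(\<Sum>x\<in>X. \<Sum>z\<in>Z. wt x z * (h x z)\<^sup>2) \<le> 15 * p * (b' * (Q * r))" .
  moreover have "(\<Sum>x\<in>X. \<Sum>z\<in>Z. wt x z * (h x z)\<^sup>2)
      = (\<Sum>x\<in>X. \<Sum>z\<in>Z. of_bool (W' x z) * (h x z)\<^sup>2) - p * (\<Sum>x\<in>X. \<Sum>z\<in>Z. (h x z)\<^sup>2)"
    unfolding wt_def by (simp add: left_diff_distrib sum_subtractf sum_distrib_left)
  ultimately show ?thesis unfolding r_def Q_def by (simp add: mult_ac)
qed

text \<open>For each fixed z the column of B is just one subset of Y, so
  \<open>sum_rows_squared_le\<close> applies column by column. Main term and jumbledness error are
  then both of order \<open>\<eta> * p ^ 3\<close>, and Cauchy-Schwarz against a degree sum of order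
  p leaves \<open>sqrt \<eta> * p\<^sup>2\<close>, a gain of \<open>sqrt \<eta>\<close> over the
  trivial order.\<close>

lemma sum_dense_le:
  assumes finZ: "finite Z" and cZ: "real (card Z) \<le> K * mZ"
    and J': "jumbled W' p b' X Z" and b': "0 \<le> b'" "b' \<le> \<eta> * p * p * sqrt (mX * mZ)"
  shows "(\<Sum>x\<in>X. \<Sum>z\<in>Z. of_bool (W' x z) * \<bar>\<Sum>y\<in>Y. f x y * of_bool (B y z)\<bar>)
    \<le> 8 * K ^ 3 * sqrt \<eta> * p\<^sup>2 * mX * mY * mZ"
proof -
  interpret XZ: sparse_pair X Z W' p K mX mZ b'
    using fin p K cX finZ cZ J' by unfold_locales
  note mZ = XZ.scales_nonneg(2)
  define h where "h x z = (\<Sum>y\<in>Y. f x y * of_bool (B y z))" for x z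
  define r where "r = (\<Sum>z\<in>Z. (\<Sum>y\<in>Y. of_bool (B y z) :: real)\<^sup>2)"
  have "b' \<le> \<eta> * (p * p * sqrt (mX * mZ))" using b' by (simp add: mult.assoc)
  also have "\<dots> \<le> 1 * (1 * p * sqrt (mX * mZ))"
    using \<eta> p scales_nonneg mZ by (intro mult_mono) auto
  finally have deg: "(\<Sum>x\<in>X. \<Sum>z\<in>Z. of_bool (W' x z)) \<le> 2 * K\<^sup>2 * p * mX * mZ"
    by (intro XZ.sum_degrees_le) simp
  have "r \<le> (\<Sum>z\<in>Z. (K * mY)\<^sup>2)"
    unfolding r_def
  proof (intro sum_mono power_mono)
    show "(\<Sum>y\<in>Y. of_bool (B y z)) \<le> K * mY" for z
      using sum_mono[of Y "\<lambda>y. of_bool (B y z)" "\<lambda>_. 1 :: real"] cY by simp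
  qed (auto intro: sum_nonneg)
  also have "\<dots> \<le> (K * mZ) * (K * mY)\<^sup>2" using cZ by (simp add: mult_right_mono)
  also have "\<dots> \<le> (K * K * mZ) * (K * mY)\<^sup>2"
    using K mZ by (intro mult_right_mono) auto
  finally have "sqrt r \<le> sqrt ((K * K * mZ) * (K * mY)\<^sup>2)" by (rule real_sqrt_le_mono)
  also have "\<dots> = K\<^sup>2 * sqrt mZ * mY" using K scales_nonneg by (simp add: real_sqrt_mult power2_eq_square)
  finally have r: "sqrt r \<le> K\<^sup>2 * sqrt mZ * mY" .
  have "(\<Sum>x\<in>X. \<Sum>z\<in>Z. (h x z)\<^sup>2) \<le> (\<Sum>z\<in>Z. 12 * K ^ 3 * \<eta> * p\<^sup>2 * mX * mY\<^sup>2)"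
    unfolding h_def by (subst sum.swap) (intro sum_mono sum_rows_squared_le)
  also have "\<dots> \<le> (K * mZ) * (12 * K ^ 3 * \<eta> * p\<^sup>2 * mX * mY\<^sup>2)"
    using cZ K scales_nonneg \<eta> by (simp add: mult_right_mono)
  finally have h2: "(\<Sum>x\<in>X. \<Sum>z\<in>Z. (h x z)\<^sup>2) \<le> 12 * K ^ 4 * \<eta> * p\<^sup>2 * mX * mY\<^sup>2 * mZ"
    by (simp add: power_numeral_reduce mult_ac)
  have "(\<Sum>x\<in>X. \<Sum>z\<in>Z. of_bool (W' x z) * (h x z)\<^sup>2)
      \<le> p * (\<Sum>x\<in>X. \<Sum>z\<in>Z. (h x z)\<^sup>2) + 15 * K\<^sup>2 * p * b' * sqrt r * sqrt mX * mY"
    unfolding h_def r_def by (rule sum_weighted_squares_le[OF finZ J' b'(1)])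
  also have "\<dots> \<le> p * (12 * K ^ 4 * \<eta> * p\<^sup>2 * mX * mY\<^sup>2 * mZ)
      + 15 * K\<^sup>2 * p * (\<eta> * p * p * sqrt (mX * mZ)) * (K\<^sup>2 * sqrt mZ * mY) * sqrt mX * mY"
    using h2 r b' K p scales_nonneg mZ \<eta>
    by (intro add_mono mult_left_mono mult_right_mono mult_mono mult_nonneg_nonneg) (auto simp: r_def intro: sum_nonneg)
  also have "\<dots> = 27 * K ^ 4 * \<eta> * p ^ 3 * mX * mY\<^sup>2 * mZ"
  proof -
    have "sqrt (mX * mZ) * sqrt mZ * sqrt mX = sqrt (mX * mZ) * sqrt (mX * mZ)"
      by (simp only: real_sqrt_mult mult_ac)
    also have "\<dots> = mX * mZ" using scales_nonneg mZ by simp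
    finally have *: "sqrt (mX * mZ) * sqrt mZ * sqrt mX = mX * mZ" .
    have "15 * K\<^sup>2 * p * (\<eta> * p * p * sqrt (mX * mZ)) * (K\<^sup>2 * sqrt mZ * mY) * sqrt mX * mY
      = 15 * K\<^sup>2 * p * (\<eta> * p * p) * (K\<^sup>2 * mY) * mY * (sqrt (mX * mZ) * sqrt mZ * sqrt mX)"
      by (simp only: mult_ac)
    then show ?thesis unfolding * by (simp add: power_numeral_reduce mult_ac)
  qed
  finally have wh2: "(\<Sum>x\<in>X. \<Sum>z\<in>Z. of_bool (W' x z) * (h x z)\<^sup>2) \<le> 27 * K ^ 4 * \<eta> * p ^ 3 * mX * mY\<^sup>2 * mZ" .
  have "(\<Sum>x\<in>X. \<Sum>z\<in>Z. of_bool (W' x z) * \<bar>h x z\<bar>)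
      \<le> sqrt (2 * K\<^sup>2 * p * mX * mZ) * sqrt (27 * K ^ 4 * \<eta> * p ^ 3 * mX * mY\<^sup>2 * mZ)"
    using deg wh2 K p scales_nonneg mZ
    by (intro order_trans[OF sum_weighted_abs_le] mult_mono real_sqrt_le_mono real_sqrt_ge_zero sum_nonneg) auto
  also have "\<dots> = sqrt (54 * (K ^ 3 * sqrt \<eta> * p\<^sup>2 * mX * mY * mZ)\<^sup>2)"
    using \<eta> unfolding real_sqrt_mult[symmetric] by (simp add: power_mult_distrib power_numeral_reduce mult_ac)
  \<comment> \<open>54 = 2 * (12 + 15), rounded up to 8 squared.\<close>
  also have "\<dots> \<le> sqrt ((8 * (K ^ 3 * sqrt \<eta> * p\<^sup>2 * mX * mY * mZ))\<^sup>2)"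
    by (intro real_sqrt_le_mono) (simp add: power_mult_distrib)
  also have "\<dots> = 8 * (K ^ 3 * sqrt \<eta> * p\<^sup>2 * mX * mY * mZ)"
    using K p scales_nonneg mZ \<eta> by (simp only: real_sqrt_abs) (intro abs_of_nonneg mult_nonneg_nonneg, auto)
  finally show ?thesis unfolding h_def by (simp only: mult.assoc)
qed

section \<open>Correlations of columns, and vertices adjacent to both sides\<close>

lemma \<eta>_le_sqrt: "\<eta> \<le> sqrt \<eta>"
  using \<eta> by (intro real_le_rsqrt) (simp add: power2_eq_square mult_left_le)

text \<open>Expanding S for a sign pattern leaves a sum of f times h, and f is not supported on W.
  The bound \<open>\<bar>f\<bar> \<le> W + 2 * p\<close> separates a part weighted by W, which is
  \<open>sum_dense_le\<close>, from a constant part, for which the cut bound in each column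
  suffices.\<close>

lemma sum_abs_correlations_le:
  assumes b0: "0 \<le> b"
  shows "(\<Sum>y\<in>Y. \<Sum>y'\<in>Y. \<bar>\<Sum>x\<in>X. f x y * f x y'\<bar>) \<le> 24 * K ^ 3 * sqrt \<eta> * p\<^sup>2 * mX * mY\<^sup>2"
proof -
  define S where "S y y' = (\<Sum>x\<in>X. f x y * f x y')" for y y'
  have *: "\<bar>\<Sum>y\<in>Y. \<Sum>y'\<in>Y. of_bool (\<sigma> y y') * S y y'\<bar> \<le> 12 * K ^ 3 * sqrt \<eta> * p\<^sup>2 * mX * mY\<^sup>2" for \<sigma>
  proof -
    define h where "h x y' = (\<Sum>y\<in>Y. f x y * of_bool (\<sigma> y y'))" for x y'
    have "(\<Sum>y\<in>Y. \<Sum>y'\<in>Y. of_bool (\<sigma> y y') * S y y')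
        = (\<Sum>y\<in>Y. \<Sum>y'\<in>Y. \<Sum>x\<in>X. f x y' * (f x y * of_bool (\<sigma> y y')))"
      unfolding S_def sum_distrib_left by (simp only: mult_ac)
    also have "\<dots> = (\<Sum>y'\<in>Y. \<Sum>x\<in>X. \<Sum>y\<in>Y. f x y' * (f x y * of_bool (\<sigma> y y')))"
      by (rule sum_triple_swap)
    also have "\<dots> = (\<Sum>x\<in>X. \<Sum>y'\<in>Y. f x y' * h x y')"
      unfolding h_def sum_distrib_left by (rule sum.swap)
    also have "\<bar>\<dots>\<bar> \<le> (\<Sum>x\<in>X. \<Sum>y'\<in>Y. of_bool (W x y') * \<bar>h x y'\<bar> + 2 * p * \<bar>h x y'\<bar>)"
    proof (intro order_trans[OF sum_abs sum_mono])
      fix x y'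
      show "\<bar>f x y' * h x y'\<bar> \<le> of_bool (W x y') * \<bar>h x y'\<bar> + 2 * p * \<bar>h x y'\<bar>"
        using mult_right_mono[OF f_le(1)[of x y'], of "\<bar>h x y'\<bar>"] by (simp add: abs_mult distrib_right)
    qed
    also have "\<dots> = (\<Sum>x\<in>X. \<Sum>y'\<in>Y. of_bool (W x y') * \<bar>h x y'\<bar>) + 2 * p * (\<Sum>y'\<in>Y. \<Sum>x\<in>X. \<bar>h x y'\<bar>)"
      by (simp only: sum.distrib sum_distrib_left) (subst (2) sum.swap, rule refl)
    also have "\<dots> \<le> 8 * K ^ 3 * sqrt \<eta> * p\<^sup>2 * mX * mY * mY + 2 * p * (\<Sum>y'\<in>Y. 2 * (\<eta> * p * mX * mY))"
      unfolding h_def using p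
      by (intro add_mono sum_dense_le[OF fin(2) cY J b0 b] mult_left_mono sum_mono sum_abs_rows_le[OF R fin]) auto
    also have "(\<Sum>y'\<in>Y. 2 * (\<eta> * p * mX * mY)) \<le> (K * mY) * (2 * (\<eta> * p * mX * mY))"
      using cY \<eta> p scales_nonneg by (simp add: mult_right_mono)
    also have "2 * p * ((K * mY) * (2 * (\<eta> * p * mX * mY))) = 4 * K * \<eta> * (p\<^sup>2 * mX * mY\<^sup>2)"
      by (simp add: power2_eq_square)
    also have "\<dots> \<le> 4 * K ^ 3 * sqrt \<eta> * (p\<^sup>2 * mX * mY\<^sup>2)"
      using K \<eta> \<eta>_le_sqrt scales_nonneg self_le_power[of K 3] by (intro mult_right_mono mult_mono) auto
    finally show ?thesis using p by (simp add: power2_eq_square mult_ac)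
  qed
  have "(\<Sum>y\<in>Y. \<Sum>y'\<in>Y. \<bar>S y y'\<bar>)
     = (\<Sum>y\<in>Y. \<Sum>y'\<in>Y. of_bool (0 \<le> S y y') * S y y') - (\<Sum>y\<in>Y. \<Sum>y'\<in>Y. of_bool (S y y' < 0) * S y y')"
    unfolding sum_subtractf[symmetric] by (intro sum.cong) auto
  then show ?thesis using *[of "\<lambda>y y'. 0 \<le> S y y'"] *[of "\<lambda>y y'. S y y' < 0"]
    unfolding S_def by linarith
qed

lemma sum_squares_eq_correlations:
  fixes B :: "'b \<Rightarrow> 'c \<Rightarrow> bool"
  shows "(\<Sum>x\<in>X. \<Sum>z\<in>Z. (\<Sum>y\<in>Y. f x y * of_bool (B y z))\<^sup>2)
    = (\<Sum>y\<in>Y. \<Sum>y'\<in>Y. (\<Sum>x\<in>X. f x y * f x y') * (\<Sum>z\<in>Z. of_bool (B y z) * of_bool (B y' z)))"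
proof -
  define g where "g s x z = (f x (fst s) * f x (snd s)) * (of_bool (B (fst s) z) * of_bool (B (snd s) z))"
    for s x z
  have "(\<Sum>x\<in>X. \<Sum>z\<in>Z. (\<Sum>y\<in>Y. f x y * of_bool (B y z))\<^sup>2) = (\<Sum>x\<in>X. \<Sum>z\<in>Z. \<Sum>s\<in>Y \<times> Y. g s x z)"
    unfolding power2_eq_square sum_product sum.cartesian_product' g_def fst_conv snd_conv
    by (simp only: mult_ac)
  also have "\<dots> = (\<Sum>s\<in>Y \<times> Y. \<Sum>x\<in>X. \<Sum>z\<in>Z. g s x z)" by (rule sum_triple_swap[symmetric])
  also have "\<dots> = (\<Sum>y\<in>Y. \<Sum>y'\<in>Y. (\<Sum>x\<in>X. f x y * f x y') * (\<Sum>z\<in>Z. of_bool (B y z) * of_bool (B y' z)))"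
    unfolding sum_product sum.cartesian_product' g_def fst_conv snd_conv ..
  finally show ?thesis .
qed

text \<open>All three classes of pairs give order p^4. Typical pairs have codegree of order p^2
  against the p^2 of the correlation sum; pairs with y in \<open>Y1\<close> have proportion of order
  p^4 and trivial codegree; pairs with y' in \<open>Y2 y\<close> have proportion of order p^3 and
  codegree of order p. The p^3 in the bound on \<open>b2\<close> is calibrated to this.\<close>

lemma sum_correlations_codegrees_le:
  fixes Z :: "'c set"
  assumes b0: "0 \<le> b" and finZ: "finite Z" and cZ: "real (card Z) \<le> K * mZ"
    and J2: "jumbled W2 p b2 Y Z" and b2: "b2 \<le> \<eta> * p ^ 3 * sqrt (mY * mZ)"
  shows "(\<Sum>y\<in>Y. \<Sum>y'\<in>Y. \<bar>\<Sum>x\<in>X. f x y * f x y'\<bar> * (\<Sum>z\<in>Z. of_bool (W2 y z) * of_bool (W2 y' z)))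
    \<le> 92 * K ^ 4 * sqrt \<eta> * p ^ 4 * mX * mY\<^sup>2 * mZ"
proof -
  interpret YZ: sparse_pair Y Z W2 p K mY mZ b2
    using fin p K cY finZ cZ J2 by unfold_locales
  note mZ = YZ.scales_nonneg(2)
  define S where "S y y' = \<bar>\<Sum>x\<in>X. f x y * f x y'\<bar>" for y y'
  define c where "c y y' = (\<Sum>z\<in>Z. of_bool (W2 y z) * of_bool (W2 y' z) :: real)" for y y'
  define D where "D y = (\<Sum>z\<in>Z. of_bool (W2 y z) :: real)" for y
  (* Y1 and the pairs in Y2 are so rare that trivial bounds for S and c suffice there. *)
  define Y1 where "Y1 = {y\<in>Y. (K + 1) * p * mZ < D y}"
  define Y2 where "Y2 y = {y'\<in>Y. (K + 1 + 1) * p * (p * mZ) < (\<Sum>z\<in>{z\<in>Z. W2 y z}. of_bool (W2 y' z))}" for y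
  have S0: "0 \<le> S y y'" for y y' unfolding S_def by simp
  have S_le: "S y y' \<le> 4 * (K * mX)" for y y'
  proof -
    have "S y y' \<le> (\<Sum>x\<in>X. 2 * 2)"
      unfolding S_def
    proof (rule order_trans[OF sum_abs sum_mono])
      show "\<bar>f x y * f x y'\<bar> \<le> 2 * 2" for x
        unfolding abs_mult by (intro mult_mono f_le) auto
    qed
    then show ?thesis using cX by simp
  qed
  have c_eq: "c y y' = (\<Sum>z\<in>{z\<in>Z. W2 y z}. of_bool (W2 y' z))" for y y'
    unfolding c_def using sum_of_bool_filter[OF finZ, of "\<lambda>z. of_bool (W2 y' z)" "W2 y"]
    by (simp add: mult.commute)
  have c0: "0 \<le> c y y'" for y y' unfolding c_def by (intro sum_nonneg) auto
  have cD: "c y y' \<le> D y" for y y' unfolding c_def D_def by (intro sum_mono) auto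
  have DZ: "D y \<le> K * mZ" for y
    using sum_mono[of Z "\<lambda>z. of_bool (W2 y z)" "\<lambda>_. 1 :: real"] cZ by (simp add: D_def)
  have "b2 \<le> (\<eta> * p\<^sup>2) * p * sqrt (mY * mZ)" using b2 by (simp add: power_numeral_reduce mult_ac)
  from few_high_degree[OF J2 fin(2) finZ this p(1) _ scales_nonneg(2) mZ cZ] K \<eta>
  have cY1: "real (card Y1) \<le> (\<eta> * p\<^sup>2)\<^sup>2 * K * mY" unfolding Y1_def D_def by simp
  have cY2: "real (card (Y2 y)) \<le> \<eta>\<^sup>2 * p ^ 3 * (2 * K) * mY" if "y \<in> Y - Y1" for y
  proof -
    define N where "N = {z\<in>Z. W2 y z}"
    have finN: "finite N" unfolding N_def using finZ by simp
    have "real (card N) = D y" unfolding N_def D_def by (rule real_card_filter[OF finZ])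
    \<comment> \<open>The neighbourhood N has scale \<open>p * mZ\<close> with constant
      \<open>K + 1\<close>, so \<open>few_high_degree\<close> yields the threshold
      \<open>K + 1 + 1\<close> used in \<open>Y2\<close>.\<close>
    then have cN: "real (card N) \<le> (K + 1) * (p * mZ)" using that by (auto simp: Y1_def mult.assoc)
    have JN: "jumbled W2 p b2 Y N" by (rule jumbled_subset[OF J2]) (auto simp: N_def)
    \<comment> \<open>Shrinking one side to scale \<open>p * mZ\<close> uses up a factor
      \<open>sqrt p\<close> of the jumbledness; what remains is t =
      \<open>\<eta> * p * sqrt p\<close>, whose square provides the p^3.\<close>
    have "b2 \<le> (\<eta> * p * sqrt p) * p * sqrt (mY * (p * mZ))"
    proof -
      have *: "sqrt p * sqrt (mY * (p * mZ)) = p * sqrt (mY * mZ)"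
        using p by (simp add: real_sqrt_mult)
      have "(\<eta> * p * sqrt p) * p * sqrt (mY * (p * mZ)) = \<eta> * p * p * (sqrt p * sqrt (mY * (p * mZ)))"
        by (simp only: mult_ac)
      also have "\<dots> = \<eta> * p ^ 3 * sqrt (mY * mZ)"
        unfolding * by (simp add: power3_eq_cube)
      finally show ?thesis using b2 by (simp only:)
    qed
    from few_high_degree[OF JN fin(2) finN this p(1) _ scales_nonneg(2) _ cN] K \<eta> p mZ
    have "real (card (Y2 y)) \<le> (\<eta> * p * sqrt p)\<^sup>2 * (K + 1) * mY" unfolding Y2_def N_def by simp
    also have "\<dots> = \<eta>\<^sup>2 * p ^ 3 * (K + 1) * mY" using p by (simp add: power_mult_distrib power_numeral_reduce)
    also have "\<dots> \<le> \<eta>\<^sup>2 * p ^ 3 * (2 * K) * mY" using K p scales_nonneg by (intro mult_right_mono mult_left_mono) auto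
    finally show ?thesis .
  qed
  define R1 where "R1 = 4 * (K * mX) * (K * mZ)"
  define R2 where "R2 = 4 * (K * mX) * (2 * K * p * mZ)"
  have R0: "0 \<le> R1" "0 \<le> R2" unfolding R1_def R2_def using K p scales_nonneg mZ by simp_all
  have pointwise: "S y y' * c y y' \<le> 3 * K * p\<^sup>2 * mZ * S y y' + (of_bool (y \<in> Y1) * R1
      + of_bool (y \<notin> Y1 \<and> y' \<in> Y2 y) * R2)" if y: "y \<in> Y" "y' \<in> Y" for y y'
  proof -
    have 0: "0 \<le> 3 * K * p\<^sup>2 * mZ * S y y'" using K p mZ S0 by simp
    consider "y \<in> Y1" | "y \<notin> Y1" "y' \<in> Y2 y" | "y \<notin> Y1" "y' \<notin> Y2 y" by blast
    then show ?thesis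
    proof cases
      case 1
      have "S y y' * c y y' \<le> R1"
        unfolding R1_def using S_le S0 c0 order_trans[OF cD DZ] K scales_nonneg by (intro mult_mono) auto
      then show ?thesis using 1 add_increasing[OF 0] by simp
    next
      case 2
      have "D y \<le> (K + 1) * (p * mZ)" using 2 y by (auto simp: Y1_def mult.assoc)
      also have "\<dots> \<le> (2 * K) * (p * mZ)" using K p mZ by (intro mult_right_mono) auto
      finally have "c y y' \<le> 2 * K * p * mZ" using cD[of y y'] by (simp add: mult.assoc)
      then have "S y y' * c y y' \<le> R2"
        unfolding R2_def using S_le S0 c0 K scales_nonneg by (intro mult_mono) auto
      then show ?thesis using 2 add_increasing[OF 0] by simp
    next
      case 3
      have "c y y' \<le> (K + 1 + 1) * p * (p * mZ)" using 3 y unfolding c_eq by (auto simp: Y2_def)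
      also have "\<dots> = (K + 2) * (p\<^sup>2 * mZ)" by (simp add: power2_eq_square)
      also have "\<dots> \<le> (3 * K) * (p\<^sup>2 * mZ)" using K p mZ by (intro mult_right_mono) auto
      finally have "S y y' * c y y' \<le> S y y' * ((3 * K) * (p\<^sup>2 * mZ))" using S0 by (rule mult_left_mono)
      then show ?thesis using 3 by (simp add: mult_ac)
    qed
  qed
  have sum1: "(\<Sum>y\<in>Y. \<Sum>y'\<in>Y. of_bool (y \<in> Y1) * R1) \<le> 4 * K ^ 4 * \<eta>\<^sup>2 * p ^ 4 * mX * mY\<^sup>2 * mZ"
  proof -
    have "real (card Y1) = (\<Sum>y\<in>Y. of_bool (y \<in> Y1))"
      using fin by (subst real_card_filter[symmetric]) (auto simp: Y1_def intro: arg_cong[where f=card])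
    then have "(\<Sum>y\<in>Y. \<Sum>y'\<in>Y. of_bool (y \<in> Y1) * R1) = real (card Y) * (real (card Y1) * R1)"
      by (simp add: sum_distrib_left sum_distrib_right)
    also have "\<dots> \<le> (K * mY) * (((\<eta> * p\<^sup>2)\<^sup>2 * K * mY) * R1)"
      using cY cY1 R0 K scales_nonneg by (intro mult_mono mult_right_mono) auto
    also have "\<dots> = 4 * K ^ 4 * \<eta>\<^sup>2 * p ^ 4 * mX * mY\<^sup>2 * mZ"
      unfolding R1_def by (simp add: power_mult_distrib power_numeral_reduce mult_ac)
    finally show ?thesis .
  qed
  have sum2: "(\<Sum>y\<in>Y. \<Sum>y'\<in>Y. of_bool (y \<notin> Y1 \<and> y' \<in> Y2 y) * R2) \<le> 16 * K ^ 4 * \<eta>\<^sup>2 * p ^ 4 * mX * mY\<^sup>2 * mZ"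
  proof -
    define t where "t = \<eta>\<^sup>2 * p ^ 3 * (2 * K) * mY"
    have t0: "0 \<le> t" unfolding t_def using K p scales_nonneg by simp
    have "(\<Sum>y\<in>Y. \<Sum>y'\<in>Y. of_bool (y \<notin> Y1 \<and> y' \<in> Y2 y) * R2) \<le> (\<Sum>y\<in>Y. t * R2)"
    proof (rule sum_mono)
      fix y assume y: "y \<in> Y"
      have "(\<Sum>y'\<in>Y. of_bool (y \<notin> Y1 \<and> y' \<in> Y2 y)) \<le> t"
      proof (cases "y \<in> Y1")
        case False
        have "(\<Sum>y'\<in>Y. of_bool (y \<notin> Y1 \<and> y' \<in> Y2 y)) = real (card (Y2 y))"
          using fin False by (subst real_card_filter[symmetric]) (auto simp: Y2_def intro: arg_cong[where f=card])
        then show ?thesis using cY2[of y] False y by (simp add: t_def)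
      qed (use t0 in simp)
      then show "(\<Sum>y'\<in>Y. of_bool (y \<notin> Y1 \<and> y' \<in> Y2 y) * R2) \<le> t * R2"
        unfolding sum_distrib_right[symmetric] using R0(2) by (rule mult_right_mono)
    qed
    also have "\<dots> \<le> (K * mY) * (t * R2)" using cY t0 R0 by (simp add: mult_right_mono)
    also have "\<dots> = 16 * K ^ 4 * \<eta>\<^sup>2 * p ^ 4 * mX * mY\<^sup>2 * mZ"
      unfolding t_def R2_def by (simp add: power_numeral_reduce mult_ac)
    finally show ?thesis .
  qed
  have "(\<Sum>y\<in>Y. \<Sum>y'\<in>Y. S y y' * c y y') \<le> (\<Sum>y\<in>Y. \<Sum>y'\<in>Y. 3 * K * p\<^sup>2 * mZ * S y y'
      + (of_bool (y \<in> Y1) * R1 + of_bool (y \<notin> Y1 \<and> y' \<in> Y2 y) * R2))"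
    by (intro sum_mono pointwise)
  also have "\<dots> = 3 * K * p\<^sup>2 * mZ * (\<Sum>y\<in>Y. \<Sum>y'\<in>Y. S y y')
      + ((\<Sum>y\<in>Y. \<Sum>y'\<in>Y. of_bool (y \<in> Y1) * R1) + (\<Sum>y\<in>Y. \<Sum>y'\<in>Y. of_bool (y \<notin> Y1 \<and> y' \<in> Y2 y) * R2))"
    by (simp only: sum.distrib sum_distrib_left)
  also have "\<dots> \<le> 3 * K * p\<^sup>2 * mZ * (24 * K ^ 3 * sqrt \<eta> * p\<^sup>2 * mX * mY\<^sup>2)
      + (4 * K ^ 4 * \<eta>\<^sup>2 * p ^ 4 * mX * mY\<^sup>2 * mZ + 16 * K ^ 4 * \<eta>\<^sup>2 * p ^ 4 * mX * mY\<^sup>2 * mZ)"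
    using sum_abs_correlations_le[OF b0] sum1 sum2 K p mZ unfolding S_def
    by (intro add_mono mult_left_mono) auto
  also have "\<dots> = 72 * sqrt \<eta> * (K ^ 4 * p ^ 4 * mX * mY\<^sup>2 * mZ) + 20 * \<eta>\<^sup>2 * (K ^ 4 * p ^ 4 * mX * mY\<^sup>2 * mZ)"
    by (simp add: power_numeral_reduce mult_ac)
  also have "\<dots> \<le> 72 * sqrt \<eta> * (K ^ 4 * p ^ 4 * mX * mY\<^sup>2 * mZ) + 20 * sqrt \<eta> * (K ^ 4 * p ^ 4 * mX * mY\<^sup>2 * mZ)"
  proof -
    have "\<eta>\<^sup>2 \<le> \<eta>" using \<eta> by (simp add: power2_eq_square mult_left_le)
    then have "\<eta>\<^sup>2 \<le> sqrt \<eta>" using \<eta>_le_sqrt by simp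
    then show ?thesis using K p scales_nonneg mZ by (intro add_left_mono mult_right_mono) auto
  qed
  finally show ?thesis unfolding S_def c_def by (simp add: mult_ac)
qed

text \<open>Compared with the one-sided case, codegrees of order p^2 improve the sum of squares to
  order p^4, and B inside W2 improves \<open>sqrt r\<close> by a factor p. With \<open>b1\<close> of
  order p^3 both terms of the weighted sum are of order p^5, so Cauchy-Schwarz gives p^3. The
  correlations already cost one square root of \<open>\<eta>\<close>, hence the fourth root.\<close>

lemma sum_sparse_le:
  fixes Z :: "'c set"
  assumes b0: "0 \<le> b" and finZ: "finite Z" and cZ: "real (card Z) \<le> K * mZ"
    and J1: "jumbled W1 p b1 X Z" and b1: "0 \<le> b1" "b1 \<le> \<eta> * p ^ 3 * sqrt (mX * mZ)"
    and J2: "jumbled W2 p b2 Y Z" and b2: "b2 \<le> \<eta> * p ^ 3 * sqrt (mY * mZ)"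
    and B: "\<And>y z. B y z \<Longrightarrow> W2 y z"
  shows "(\<Sum>x\<in>X. \<Sum>z\<in>Z. of_bool (W1 x z) * \<bar>\<Sum>y\<in>Y. f x y * of_bool (B y z)\<bar>)
    \<le> 17 * K ^ 3 * sqrt (sqrt \<eta>) * p ^ 3 * mX * mY * mZ"
proof -
  interpret XZ: sparse_pair X Z W1 p K mX mZ b1
    using fin p K cX finZ cZ J1 by unfold_locales
  interpret ZY: sparse_pair Z Y "\<lambda>z y. W2 y z" p K mZ mY b2
    using fin p K cY finZ cZ jumbled_swap[OF J2] by unfold_locales
  note mZ = XZ.scales_nonneg(2)
  define h where "h x z = (\<Sum>y\<in>Y. f x y * of_bool (B y z))" for x z
  define r where "r = (\<Sum>z\<in>Z. (\<Sum>y\<in>Y. of_bool (B y z) :: real)\<^sup>2)"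
  define S where "S y y' = (\<Sum>x\<in>X. f x y * f x y')" for y y'
  have \<eta>p: "\<eta> * p ^ 3 \<le> p" "\<eta> * p ^ 3 \<le> p * p"
  proof -
    have "\<eta> * p ^ 3 \<le> 1 * p ^ 3" using \<eta> p by (intro mult_right_mono) auto
    moreover have "p ^ 3 \<le> p ^ 2" "p ^ 3 \<le> p ^ 1" using p by (intro power_decreasing; simp)+
    ultimately show "\<eta> * p ^ 3 \<le> p" "\<eta> * p ^ 3 \<le> p * p" by (simp_all add: power2_eq_square)
  qed
  have "b1 \<le> p * sqrt (mX * mZ)"
    using b1(2) mult_right_mono[OF \<eta>p(1), of "sqrt (mX * mZ)"] scales_nonneg mZ by simp
  then have deg: "(\<Sum>x\<in>X. \<Sum>z\<in>Z. of_bool (W1 x z)) \<le> 2 * K\<^sup>2 * p * mX * mZ"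
    by (rule XZ.sum_degrees_le)
  have "b2 \<le> p * p * sqrt (mZ * mY)"
    using b2 mult_right_mono[OF \<eta>p(2), of "sqrt (mZ * mY)"] scales_nonneg mZ by (simp add: mult.commute)
  then have "(\<Sum>z\<in>Z. (\<Sum>y\<in>Y. of_bool (W2 y z))\<^sup>2) \<le> 5 * K ^ 3 * p\<^sup>2 * mZ * mY\<^sup>2"
    by (rule ZY.sum_degrees_squared_le)
  moreover have "r \<le> (\<Sum>z\<in>Z. (\<Sum>y\<in>Y. of_bool (W2 y z))\<^sup>2)"
    unfolding r_def using B by (intro sum_mono power_mono sum_nonneg) auto
  moreover have "5 * K ^ 3 * p\<^sup>2 * mZ * mY\<^sup>2 \<le> 9 * K ^ 4 * p\<^sup>2 * mZ * mY\<^sup>2"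
    using K p mZ power_increasing[of 3 4 K] by (intro mult_right_mono mult_mono) auto
  ultimately have "sqrt r \<le> sqrt (9 * K ^ 4 * p\<^sup>2 * mZ * mY\<^sup>2)" by simp
  also have "\<dots> = sqrt ((3 * K\<^sup>2 * p * sqrt mZ * mY)\<^sup>2)" using mZ by (simp add: power_mult_distrib)
  also have "\<dots> = 3 * K\<^sup>2 * p * sqrt mZ * mY" using K p scales_nonneg mZ by simp
  finally have r: "sqrt r \<le> 3 * K\<^sup>2 * p * sqrt mZ * mY" .
  have "(\<Sum>x\<in>X. \<Sum>z\<in>Z. (h x z)\<^sup>2)
      = (\<Sum>y\<in>Y. \<Sum>y'\<in>Y. S y y' * (\<Sum>z\<in>Z. of_bool (B y z) * of_bool (B y' z)))"
    unfolding h_def S_def by (rule sum_squares_eq_correlations)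
  also have "\<dots> \<le> (\<Sum>y\<in>Y. \<Sum>y'\<in>Y. \<bar>S y y'\<bar> * (\<Sum>z\<in>Z. of_bool (W2 y z) * of_bool (W2 y' z)))"
  proof (intro sum_mono)
    fix y y'
    have "(\<Sum>z\<in>Z. of_bool (B y z) * of_bool (B y' z) :: real) \<le> (\<Sum>z\<in>Z. of_bool (W2 y z) * of_bool (W2 y' z))"
    proof (rule sum_mono)
      show "of_bool (B y z) * of_bool (B y' z) \<le> (of_bool (W2 y z) * of_bool (W2 y' z) :: real)" for z
        using B[of y z] B[of y' z] by (cases "B y z"; cases "B y' z") auto
    qed
    then show "S y y' * (\<Sum>z\<in>Z. of_bool (B y z) * of_bool (B y' z))
        \<le> \<bar>S y y'\<bar> * (\<Sum>z\<in>Z. of_bool (W2 y z) * of_bool (W2 y' z))"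
      by (intro mult_mono abs_ge_self) (auto intro: sum_nonneg)
  qed
  also have "\<dots> \<le> 92 * K ^ 4 * sqrt \<eta> * p ^ 4 * mX * mY\<^sup>2 * mZ"
    unfolding S_def by (rule sum_correlations_codegrees_le[OF b0 finZ cZ J2 b2])
  finally have h2: "(\<Sum>x\<in>X. \<Sum>z\<in>Z. (h x z)\<^sup>2) \<le> 92 * K ^ 4 * sqrt \<eta> * p ^ 4 * mX * mY\<^sup>2 * mZ" .
  have "(\<Sum>x\<in>X. \<Sum>z\<in>Z. of_bool (W1 x z) * (h x z)\<^sup>2)
      \<le> p * (\<Sum>x\<in>X. \<Sum>z\<in>Z. (h x z)\<^sup>2) + 15 * K\<^sup>2 * p * b1 * sqrt r * sqrt mX * mY"
    unfolding h_def r_def by (rule sum_weighted_squares_le[OF finZ J1 b1(1)])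
  also have "\<dots> \<le> p * (92 * K ^ 4 * sqrt \<eta> * p ^ 4 * mX * mY\<^sup>2 * mZ)
      + 15 * K\<^sup>2 * p * (sqrt \<eta> * p ^ 3 * sqrt (mX * mZ)) * (3 * K\<^sup>2 * p * sqrt mZ * mY) * sqrt mX * mY"
  proof -
    note b1(2)
    also have "\<eta> * p ^ 3 * sqrt (mX * mZ) \<le> sqrt \<eta> * p ^ 3 * sqrt (mX * mZ)"
      using p scales_nonneg mZ by (intro mult_right_mono \<eta>_le_sqrt) auto
    finally show ?thesis
      using h2 r b1 K p scales_nonneg mZ \<eta>
      by (intro add_mono mult_left_mono mult_right_mono mult_mono mult_nonneg_nonneg) (auto simp: r_def intro: sum_nonneg)
  qed
  also have "\<dots> = 137 * K ^ 4 * sqrt \<eta> * p ^ 5 * mX * mY\<^sup>2 * mZ"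
  proof -
    have "sqrt (mX * mZ) * sqrt mZ * sqrt mX = sqrt (mX * mZ) * sqrt (mX * mZ)"
      by (simp only: real_sqrt_mult mult_ac)
    also have "\<dots> = mX * mZ" using scales_nonneg mZ by simp
    finally have *: "sqrt (mX * mZ) * sqrt mZ * sqrt mX = mX * mZ" .
    have "15 * K\<^sup>2 * p * (sqrt \<eta> * p ^ 3 * sqrt (mX * mZ)) * (3 * K\<^sup>2 * p * sqrt mZ * mY) * sqrt mX * mY
      = 15 * K\<^sup>2 * p * (sqrt \<eta> * p ^ 3) * (3 * K\<^sup>2 * p * mY) * mY * (sqrt (mX * mZ) * sqrt mZ * sqrt mX)"
      by (simp only: mult_ac)
    then show ?thesis unfolding * by (simp add: power_numeral_reduce mult_ac)
  qed
  finally have wh2: "(\<Sum>x\<in>X. \<Sum>z\<in>Z. of_bool (W1 x z) * (h x z)\<^sup>2) \<le> 137 * K ^ 4 * sqrt \<eta> * p ^ 5 * mX * mY\<^sup>2 * mZ" .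
  have "(\<Sum>x\<in>X. \<Sum>z\<in>Z. of_bool (W1 x z) * \<bar>h x z\<bar>)
      \<le> sqrt (2 * K\<^sup>2 * p * mX * mZ) * sqrt (137 * K ^ 4 * sqrt \<eta> * p ^ 5 * mX * mY\<^sup>2 * mZ)"
    using deg wh2 K p scales_nonneg mZ
    by (intro order_trans[OF sum_weighted_abs_le] mult_mono real_sqrt_le_mono real_sqrt_ge_zero sum_nonneg) auto
  also have "\<dots> = sqrt (274 * (K ^ 3 * sqrt (sqrt \<eta>) * p ^ 3 * mX * mY * mZ)\<^sup>2)"
    using \<eta> unfolding real_sqrt_mult[symmetric] by (simp add: power_mult_distrib power_numeral_reduce mult_ac)
  \<comment> \<open>274 = 2 * (92 + 45), rounded up to 17 squared.\<close>
  also have "\<dots> \<le> sqrt ((17 * (K ^ 3 * sqrt (sqrt \<eta>) * p ^ 3 * mX * mY * mZ))\<^sup>2)"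
    by (intro real_sqrt_le_mono) (simp add: power_mult_distrib)
  also have "\<dots> = 17 * (K ^ 3 * sqrt (sqrt \<eta>) * p ^ 3 * mX * mY * mZ)"
    using K p scales_nonneg mZ \<eta> by (simp only: real_sqrt_abs) (intro abs_of_nonneg mult_nonneg_nonneg, auto)
  finally show ?thesis unfolding h_def by (simp only: mult.assoc)
qed

text \<open>Each irregular z supplies a violating rectangle \<open>A z\<close>, \<open>C z\<close>.
  The sets \<open>C z\<close> are assembled into the single relation B, and \<open>A z\<close>
  disappears by taking absolute values of h over the whole neighbourhood of z. Taking
  \<open>W2\<close> to be always true covers the case where z is not adjacent to Y.\<close>

lemma card_irregular_le:
  fixes Z :: "'c set"
  assumes finZ: "finite Z"
    and Q: "\<And>B. (\<And>y z. B y z \<Longrightarrow> W2 y z) \<Longrightarrow>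
      (\<Sum>x\<in>X. \<Sum>z\<in>Z. of_bool (W1 x z) * \<bar>\<Sum>y\<in>Y. f x y * of_bool (B y z)\<bar>) \<le> Q"
  shows "real (card {z\<in>Z. \<not> cut_bounded f e {x\<in>X. W1 x z} {y\<in>Y. W2 y z}}) * e \<le> Q"
proof -
  define T where "T = {z\<in>Z. \<not> cut_bounded f e {x\<in>X. W1 x z} {y\<in>Y. W2 y z}}"
  have "\<forall>z\<in>T. \<exists>q. fst q \<subseteq> {x\<in>X. W1 x z} \<and> snd q \<subseteq> {y\<in>Y. W2 y z} \<and> e < \<bar>\<Sum>x\<in>fst q. \<Sum>y\<in>snd q. f x y\<bar>"
    unfolding T_def cut_bounded_def by (auto simp: not_le)
  from bchoice[OF this] obtain q where q: "\<forall>z\<in>T. fst (q z) \<subseteq> {x\<in>X. W1 x z} \<and>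
    snd (q z) \<subseteq> {y\<in>Y. W2 y z} \<and> e < \<bar>\<Sum>x\<in>fst (q z). \<Sum>y\<in>snd (q z). f x y\<bar>" ..
  define A where "A z = fst (q z)" for z
  define C where "C z = snd (q z)" for z
  have A: "A z \<subseteq> {x\<in>X. W1 x z}" and C: "C z \<subseteq> {y\<in>Y. W2 y z}"
    and e: "e < \<bar>\<Sum>x\<in>A z. \<Sum>y\<in>C z. f x y\<bar>" if "z \<in> T" for z
    using bspec[OF q that] unfolding A_def C_def by simp_all
  define B where "B y z \<longleftrightarrow> z \<in> T \<and> y \<in> C z" for y z
  define h where "h x z = (\<Sum>y\<in>Y. f x y * of_bool (B y z))" for x z
  have T: "T \<subseteq> Z" unfolding T_def by auto
  have "real (card T) * e = (\<Sum>z\<in>T. e)" by simp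
  also have "\<dots> \<le> (\<Sum>z\<in>T. \<Sum>x\<in>X. of_bool (W1 x z) * \<bar>h x z\<bar>)"
  proof (rule sum_mono)
    fix z assume z: "z \<in> T"
    have "h x z = (\<Sum>y\<in>C z. f x y)" for x
    proof -
      have "{y\<in>Y. B y z} = C z" using C[OF z] z by (auto simp: B_def)
      then show ?thesis unfolding h_def by (simp only: sum_of_bool_filter[OF fin(2)])
    qed
    then have "e \<le> \<bar>\<Sum>x\<in>A z. h x z\<bar>" using e[OF z] by simp
    also have "\<dots> \<le> (\<Sum>x\<in>A z. \<bar>h x z\<bar>)" by (rule sum_abs)
    also have "\<dots> \<le> (\<Sum>x\<in>{x\<in>X. W1 x z}. \<bar>h x z\<bar>)"
      using A[OF z] fin by (intro sum_mono2) auto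
    also have "\<dots> = (\<Sum>x\<in>X. of_bool (W1 x z) * \<bar>h x z\<bar>)"
      unfolding sum_of_bool_filter[OF fin(1), symmetric] by (simp only: mult.commute)
    finally show "e \<le> (\<Sum>x\<in>X. of_bool (W1 x z) * \<bar>h x z\<bar>)" .
  qed
  also have "\<dots> \<le> (\<Sum>z\<in>Z. \<Sum>x\<in>X. of_bool (W1 x z) * \<bar>h x z\<bar>)"
    using T finZ by (intro sum_mono2 sum_nonneg) auto
  also have "\<dots> = (\<Sum>x\<in>X. \<Sum>z\<in>Z. of_bool (W1 x z) * \<bar>h x z\<bar>)" by (rule sum.swap)
  also have "\<dots> \<le> Q"
    unfolding h_def by (rule Q) (use C in \<open>auto simp: B_def\<close>)
  finally show ?thesis unfolding T_def .
qed

text \<open>This covers the degenerate case in which the inheritance bounds cannot be divided by the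
  scales: a zero scale forces an empty side.\<close>

lemma card_irregular_eq_0:
  assumes "mX * mY = 0"
  shows "{z\<in>Z. \<not> cut_bounded f 0 {x\<in>X. P x z} {y\<in>Y. P' y z}} = {}"
proof -
  have "X = {} \<or> Y = {}" using assms cX cY fin by auto
  then show ?thesis
  proof
    assume "X = {}" then show ?thesis by (auto simp: cut_bounded_def)
  next
    assume "Y = {}" then show ?thesis by (auto simp: cut_bounded_def)
  qed
qed

text \<open>The threshold is \<open>\<theta>\<close> relative to the new scales
  \<open>p * mX\<close> and \<open>mY\<close>, so the powers of p and the scales cancel against
  \<open>sum_dense_le\<close> and only \<open>sqrt \<eta>\<close> survives.\<close>

lemma one_sided_inheritance:
  fixes Z :: "'c set"
  assumes finZ: "finite Z" and cZ: "real (card Z) \<le> K * mZ"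
    and J': "jumbled W' p b' X Z" and b': "0 \<le> b'" "b' \<le> \<eta> * p * p * sqrt (mX * mZ)"
  shows "\<theta> * real (card {z\<in>Z. \<not> cut_bounded f (\<theta> * p * (p * mX) * mY) {x\<in>X. W' x z} Y}) \<le> 8 * K ^ 3 * sqrt \<eta> * mZ"
    (is "\<theta> * ?n \<le> _")
proof -
  have mZ: "0 \<le> mZ" using order_trans[OF of_nat_0_le_iff cZ] K by (simp add: zero_le_mult_iff)
  have n: "?n * (\<theta> * p * (p * mX) * mY) \<le> 8 * K ^ 3 * sqrt \<eta> * p\<^sup>2 * mX * mY * mZ"
    using card_irregular_le[OF finZ, of "\<lambda>_ _. True" W'] sum_dense_le[OF finZ cZ J' b'] by simp
  show ?thesis
  proof (cases "mX * mY = 0")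
    case True
    then have *: "\<theta> * p * (p * mX) * mY = 0" by auto
    have "{z\<in>Z. \<not> cut_bounded f 0 {x\<in>X. W' x z} Y} = {}"
      using card_irregular_eq_0[OF True, of Z W' "\<lambda>_ _. True"] by simp
    then have "?n = 0" unfolding * by (simp only: card.empty of_nat_0)
    then show ?thesis using K mZ \<eta> by simp
  next
    case False
    then have pos: "0 < p\<^sup>2 * (mX * mY)" using scales_nonneg p by (simp add: less_le)
    have "(\<theta> * ?n) * (p\<^sup>2 * (mX * mY)) \<le> (8 * K ^ 3 * sqrt \<eta> * mZ) * (p\<^sup>2 * (mX * mY))"
      using n by (simp add: power2_eq_square mult_ac)
    then show ?thesis using pos by (rule mult_right_le_imp_le)
  qed
qed

text \<open>The same cancellation against \<open>sum_sparse_le\<close>, now with both scales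
  multiplied by p.\<close>

lemma two_sided_inheritance:
  fixes Z :: "'c set"
  assumes b0: "0 \<le> b" and finZ: "finite Z" and cZ: "real (card Z) \<le> K * mZ"
    and J1: "jumbled W1 p b1 X Z" and b1: "0 \<le> b1" "b1 \<le> \<eta> * p ^ 3 * sqrt (mX * mZ)"
    and J2: "jumbled W2 p b2 Y Z" and b2: "b2 \<le> \<eta> * p ^ 3 * sqrt (mY * mZ)"
  shows "\<theta> * real (card {z\<in>Z. \<not> cut_bounded f (\<theta> * p * (p * mX) * (p * mY)) {x\<in>X. W1 x z} {y\<in>Y. W2 y z}})
    \<le> 17 * K ^ 3 * sqrt (sqrt \<eta>) * mZ"
    (is "\<theta> * ?n \<le> _")
proof -
  have mZ: "0 \<le> mZ" using order_trans[OF of_nat_0_le_iff cZ] K by (simp add: zero_le_mult_iff)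
  have n: "?n * (\<theta> * p * (p * mX) * (p * mY)) \<le> 17 * K ^ 3 * sqrt (sqrt \<eta>) * p ^ 3 * mX * mY * mZ"
    by (rule card_irregular_le[OF finZ]) (rule sum_sparse_le[OF b0 finZ cZ J1 b1 J2 b2])
  show ?thesis
  proof (cases "mX * mY = 0")
    case True
    then have *: "\<theta> * p * (p * mX) * (p * mY) = 0" by auto
    have "?n = 0" unfolding * card_irregular_eq_0[OF True, of Z W1 W2] by simp
    then show ?thesis using K mZ \<eta> by simp
  next
    case False
    then have pos: "0 < p ^ 3 * (mX * mY)" using scales_nonneg p by (simp add: less_le)
    have "(\<theta> * ?n) * (p ^ 3 * (mX * mY)) \<le> (17 * K ^ 3 * sqrt (sqrt \<eta>) * mZ) * (p ^ 3 * (mX * mY))"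
      using n by (simp add: power3_eq_cube mult_ac)
    then show ?thesis using pos by (rule mult_right_le_imp_le)
  qed
qed

end

section \<open>Embedding one vertex\<close>

definition adj :: "nat ugraph \<Rightarrow> nat \<Rightarrow> nat \<Rightarrow> bool" where
  "adj H j k \<longleftrightarrow> {j, k} \<in> edges H"

definition scale :: "nat ugraph \<Rightarrow> real \<Rightarrow> (nat \<Rightarrow> real) \<Rightarrow> nat \<Rightarrow> nat \<Rightarrow> real" where
  "scale H p n i j = p ^ card (nbrs_below H i j) * n j"

text \<open>These are the edges not yet realised before vertex i is embedded; ordering the pair
  counts each edge once.\<close>

definition forward_edges :: "nat ugraph \<Rightarrow> nat \<Rightarrow> (nat \<times> nat) set" where
  "forward_edges H i = {(j, k). i \<le> j \<and> j < k \<and> adj H j k}"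

definition partial_copies ::
  "nat ugraph \<Rightarrow> nat \<Rightarrow> ('v \<Rightarrow> 'v \<Rightarrow> bool) \<Rightarrow> nat \<Rightarrow> (nat \<Rightarrow> 'v set) \<Rightarrow> (nat \<Rightarrow> 'v) set" where
  "partial_copies H m E i C = {\<phi> \<in> (\<Pi>\<^sub>E j\<in>{i..m}. C j).
     \<forall>j\<in>{i..m}. \<forall>k\<in>{i..m}. adj H j k \<longrightarrow> E (\<phi> j) (\<phi> k)}"

definition candidates_after ::
  "nat ugraph \<Rightarrow> ('v \<Rightarrow> 'v \<Rightarrow> bool) \<Rightarrow> nat \<Rightarrow> (nat \<Rightarrow> 'v set) \<Rightarrow> 'v \<Rightarrow> nat \<Rightarrow> 'v set" where
  "candidates_after H E i C z j = {v \<in> C j. adj H i j \<longrightarrow> E v z}"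

lemma adj_commute: "adj H j k \<longleftrightarrow> adj H k j"
  by (simp add: adj_def insert_commute)

lemma adj_in_verts:
  assumes "simple_graph H" "verts H = {1..m}" "adj H j k"
  shows "j \<in> {1..m} \<and> k \<in> {1..m} \<and> j \<noteq> k"
  using assms unfolding simple_graph_def adj_def by fastforce

lemma jumbled_mono: "jumbled W p b X Y \<Longrightarrow> b \<le> b' \<Longrightarrow> jumbled W p b' X Y"
  unfolding jumbled_def
  by (meson mult_right_mono of_nat_0_le_iff order_trans real_sqrt_ge_zero mult_nonneg_nonneg)

text \<open>q stands for p to the power \<open>k_reg H\<close>, and the hypotheses on q are squared
  so that the halved back-degrees become natural exponents. In \<open>q_path\<close> the choice k =
  i is allowed and treats the pair of j with the vertex being embedded; \<open>q_triangle\<close> is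
  the stronger demand on that pair when i, j, k form a triangle.\<close>

locale counting_frame =
  fixes H :: "nat ugraph" and m :: nat and p q :: real and E W :: "'v \<Rightarrow> 'v \<Rightarrow> bool"
    and n :: "nat \<Rightarrow> real" and d :: "nat \<Rightarrow> nat \<Rightarrow> real"
  assumes H: "simple_graph H" "verts H = {1..m}"
    and p: "0 < p" "p \<le> 1" and q: "0 \<le> q" and n: "\<And>j. 0 \<le> n j"
    and q_path: "\<And>i j k. i < j \<Longrightarrow> i \<le> k \<Longrightarrow> adj H i j \<Longrightarrow> adj H j k \<Longrightarrow>
      q\<^sup>2 \<le> p ^ (4 + card (nbrs_below H i j) + card (nbrs_below H i k))"
    and q_triangle: "\<And>i j k. i < j \<Longrightarrow> i < k \<Longrightarrow> adj H i j \<Longrightarrow> adj H j k \<Longrightarrow> adj H i k \<Longrightarrow>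
      q\<^sup>2 \<le> p ^ (6 + card (nbrs_below H i j) + card (nbrs_below H i i))"
    and E_sym: "\<And>x y. E x y \<longleftrightarrow> E y x" and W_sym: "\<And>x y. W x y \<longleftrightarrow> W y x"
    and EW: "\<And>x y. E x y \<Longrightarrow> W x y"
    and d_sym: "\<And>j k. d j k = d k j"
    and d: "\<And>j k. adj H j k \<Longrightarrow> 0 \<le> d j k" "\<And>j k. adj H j k \<Longrightarrow> d j k \<le> 2"
begin

abbreviation M :: "nat \<Rightarrow> nat \<Rightarrow> real" where "M \<equiv> scale H p n"

text \<open>Jumbledness passes to subsets unchanged, so it stays expressed in the initial sizes n,
  while the regularity error must shrink with the current scales. The density \<open>d j k\<close>
  is that of the original pair at every stage.\<close>

definition regular_state :: "nat \<Rightarrow> real \<Rightarrow> real \<Rightarrow> (nat \<Rightarrow> 'v set) \<Rightarrow> bool" where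
  "regular_state i K \<eta> C \<longleftrightarrow>
    (\<forall>j\<in>{i..m}. finite (C j) \<and> real (card (C j)) \<le> K * M i j) \<and>
    (\<forall>j\<in>{i..m}. \<forall>k\<in>{i..m}. adj H j k \<longrightarrow>
      jumbled W p (\<eta> * q * sqrt (n j * n k)) (C j) (C k) \<and>
      cut_bounded (\<lambda>x y. of_bool (E x y) - d j k * p) (\<eta> * p * M i j * M i k) (C j) (C k))"

lemmas adj_verts = adj_in_verts[OF H]

lemma M_nonneg: "0 \<le> M i j"
  unfolding scale_def using p n by simp

lemma M_Suc: "M (Suc i) j = (if adj H i j then p * M i j else M i j)"
proof -
  have fin: "finite (nbrs_below H i j)"
    by (rule finite_subset[of _ "{..<i}"]) (auto simp: nbrs_below_def)
  have "nbrs_below H (Suc i) j = (if adj H i j then insert i (nbrs_below H i j) else nbrs_below H i j)"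
    by (auto simp: nbrs_below_def adj_def less_Suc_eq insert_commute)
  moreover have "i \<notin> nbrs_below H i j" by (simp add: nbrs_below_def)
  ultimately show ?thesis using fin by (simp add: scale_def)
qed

text \<open>Passing from initial sizes to current scales divides by p to half the sum of the two
  back-degrees; the exponent in the hypothesis absorbs this and leaves \<open>p ^ e\<close>.\<close>

lemma q_sqrt_le:
  assumes "q\<^sup>2 \<le> p ^ (2 * e + card (nbrs_below H i j) + card (nbrs_below H i k))"
  shows "q * sqrt (n j * n k) \<le> p ^ e * sqrt (M i j * M i k)"
proof -
  have "q * sqrt (n j * n k) = sqrt (q\<^sup>2 * (n j * n k))" using q by (simp add: real_sqrt_mult)
  also have "\<dots> \<le> sqrt (p ^ (2 * e + card (nbrs_below H i j) + card (nbrs_below H i k)) * (n j * n k))"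
    using assms n by (intro real_sqrt_le_mono mult_right_mono) auto
  also have "\<dots> = sqrt ((p ^ e)\<^sup>2 * (M i j * M i k))"
    unfolding scale_def by (simp add: power_add power_mult[symmetric] mult_ac)
  also have "\<dots> = p ^ e * sqrt (M i j * M i k)" using p by (simp add: real_sqrt_mult)
  finally show ?thesis .
qed

text \<open>One step: \<open>\<eta>\<close> is the regularity error before it and
  \<open>\<eta>'\<close> the one after it, \<open>\<theta>\<close> the tolerated deficit of a
  candidate set, \<open>\<rho>\<close> the proportion of each kind of exceptional vertex. The three
  conditions in \<open>small\<close> serve, in this order, low degrees, high degrees and irregular
  pairs.\<close>

context
  fixes i :: nat and K \<eta> \<eta>' \<theta> \<rho> :: real and C :: "nat \<Rightarrow> 'v set"
  assumes st: "regular_state i K \<eta> C" and i: "i \<in> {1..m}" and K: "1 \<le> K"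
    and \<eta>: "0 \<le> \<eta>" "\<eta> \<le> 1" "\<eta> \<le> \<eta>'" and \<rho>: "0 \<le> \<rho>" and \<theta>: "0 < \<theta>"
    and small: "\<eta> \<le> \<theta> * \<rho>" "\<eta> * K \<le> \<rho>" "17 * K ^ 3 * sqrt (sqrt \<eta>) \<le> \<eta>' * \<rho>"
begin

lemma state_finite: "j \<in> {i..m} \<Longrightarrow> finite (C j)" and state_card: "j \<in> {i..m} \<Longrightarrow> real (card (C j)) \<le> K * M i j"
  using st unfolding regular_state_def by auto

lemma state_jumbled: "adj H j k \<Longrightarrow> i \<le> j \<Longrightarrow> i \<le> k \<Longrightarrow> jumbled W p (\<eta> * q * sqrt (n j * n k)) (C j) (C k)"
  and state_cut: "adj H j k \<Longrightarrow> i \<le> j \<Longrightarrow> i \<le> k \<Longrightarrow>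
    cut_bounded (\<lambda>x y. of_bool (E x y) - d j k * p) (\<eta> * p * M i j * M i k) (C j) (C k)"
  using st adj_verts[of j k] unfolding regular_state_def by auto

lemma jumbledness_nonneg: "0 \<le> \<eta> * q * sqrt (n j * n k)"
  using \<eta> q n by simp

lemma jumbledness_path:
  assumes "i < j" "i \<le> k" "adj H i j" "adj H j k"
  shows "\<eta> * q * sqrt (n j * n k) \<le> \<eta> * p * p * sqrt (M i j * M i k)"
proof -
  have "q * sqrt (n j * n k) \<le> p\<^sup>2 * sqrt (M i j * M i k)"
    by (rule q_sqrt_le) (use q_path[OF assms] in simp)
  then show ?thesis using mult_left_mono[OF _ \<eta>(1)] by (fastforce simp: power2_eq_square mult.assoc)
qed

lemma jumbledness_triangle:
  assumes "i < j" "i < k" "adj H i j" "adj H j k" "adj H i k"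
  shows "\<eta> * q * sqrt (n j * n i) \<le> \<eta> * p ^ 3 * sqrt (M i j * M i i)"
proof -
  have "q * sqrt (n j * n i) \<le> p ^ 3 * sqrt (M i j * M i i)"
    by (rule q_sqrt_le) (use q_triangle[OF assms] in simp)
  then show ?thesis using mult_left_mono[OF _ \<eta>(1)] by (fastforce simp: mult.assoc)
qed

text \<open>The prediction uses the actual size of \<open>C j\<close>, since the main term of the
  count does; only the tolerated deficit is measured by the scale.\<close>

definition low_degree :: "nat \<Rightarrow> 'v set" where
  "low_degree j = {z \<in> C i. (\<Sum>v\<in>C j. of_bool (E z v)) < d i j * p * real (card (C j)) - \<theta> * p * M i j}"

definition high_degree :: "nat \<Rightarrow> 'v set" where
  "high_degree j = {z \<in> C i. (K + 1) * p * M i j < (\<Sum>v\<in>C j. of_bool (W z v))}"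

(* The implications make this uniform in whether none, one or both of j, k are neighbours of i. *)
definition irregular :: "nat \<Rightarrow> nat \<Rightarrow> 'v set" where
  "irregular j k = {z \<in> C i. \<not> cut_bounded (\<lambda>x y. of_bool (E x y) - d j k * p)
     (\<eta>' * p * M (Suc i) j * M (Suc i) k) {x \<in> C j. adj H i j \<longrightarrow> W x z} {y \<in> C k. adj H i k \<longrightarrow> W y z}}"

text \<open>The cut bound is tested on the set of deficient vertices against all of
  \<open>C j\<close>; each contributes at least \<open>\<theta> * p * M i j\<close>.\<close>

lemma card_low_degree:
  assumes j: "i < j" "adj H i j"
  shows "real (card (low_degree j)) \<le> \<rho> * M i i"
proof (cases "M i j = 0")
  case True
  then have "C j = {}" using state_card[of j] state_finite[of j] j adj_verts[OF j(2)] by auto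
  then have "low_degree j = {}" using True by (simp add: low_degree_def)
  then show ?thesis using \<rho> M_nonneg by simp
next
  case False
  then have M: "0 < M i j" using M_nonneg[of i j] by linarith
  have "real (card (low_degree j)) * (\<theta> * p * M i j) = (\<Sum>z\<in>low_degree j. \<theta> * p * M i j)" by simp
  also have "\<dots> \<le> (\<Sum>z\<in>low_degree j. - (\<Sum>v\<in>C j. of_bool (E z v) - d i j * p))"
    by (rule sum_mono) (simp add: low_degree_def sum_subtractf mult.commute)
  also have "\<dots> \<le> \<eta> * p * M i i * M i j"
    using cut_boundedD[OF state_cut[of i j], of "low_degree j" "C j"] j
    by (auto simp: low_degree_def sum_negf)
  also have "\<dots> \<le> (\<theta> * \<rho>) * p * M i i * M i j"
    using small(1) p M_nonneg by (intro mult_right_mono) auto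
  finally have "real (card (low_degree j)) * (\<theta> * p * M i j) \<le> (\<rho> * M i i) * (\<theta> * p * M i j)"
    by (simp add: mult_ac)
  then show ?thesis by (rule mult_right_le_imp_le) (use \<theta> p M in simp)
qed

lemma card_high_degree:
  assumes j: "i < j" "adj H i j"
  shows "real (card (high_degree j)) \<le> \<rho> * M i i"
proof -
  \<comment> \<open>The degenerate path i, j, i: \<open>jumbledness_path\<close> with k = i, which
    gives t = \<open>\<eta> * p\<close>.\<close>
  have b: "\<eta> * q * sqrt (n i * n j) \<le> (\<eta> * p) * p * sqrt (M i i * M i j)"
    using jumbledness_path[of j i] j by (simp add: adj_commute[of H j] mult.commute[of "n j"] mult.commute[of "M i j"])
  have "real (card (high_degree j)) \<le> (\<eta> * p)\<^sup>2 * K * M i i"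
    unfolding high_degree_def
    using few_high_degree[OF state_jumbled[of i j] state_finite state_finite b] j i adj_verts[OF j(2)] state_card[of j] M_nonneg K p \<eta>
    by simp
  also have "\<dots> \<le> \<rho> * M i i"
  proof (rule mult_right_mono)
    have "(\<eta> * p)\<^sup>2 \<le> \<eta> * p" "\<eta> * p \<le> \<eta>"
      using \<eta> p mult_le_one[of \<eta> p] by (simp_all add: power2_eq_square mult_left_le)
    then have "(\<eta> * p)\<^sup>2 * K \<le> \<eta> * K" using K by (intro mult_right_mono) auto
    then show "(\<eta> * p)\<^sup>2 * K \<le> \<rho>" using small(2) by simp
  qed (rule M_nonneg)
  finally show ?thesis .
qed

lemma \<eta>'_card_le:
  assumes "\<eta>' * real (card T) \<le> 17 * K ^ 3 * sqrt (sqrt \<eta>) * M i i" "0 < \<eta>'"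
  shows "real (card T) \<le> \<rho> * M i i"
proof -
  have "\<eta>' * real (card T) \<le> \<eta>' * \<rho> * M i i"
    using assms(1) mult_right_mono[OF small(3) M_nonneg[of i i]] by linarith
  then have "\<eta>' * real (card T) \<le> \<eta>' * (\<rho> * M i i)" by (simp add: mult.assoc)
  then show ?thesis using assms(2) by (rule mult_left_le_imp_le)
qed

text \<open>The number of neighbours of i among j and k decides between two-sided inheritance,
  one-sided inheritance and no change at all. The one-sided bound is weakened to the two-sided one
  so that a single smallness condition serves both.\<close>

lemma card_irregular:
  assumes j: "i < j" "i < k" "adj H j k" and \<eta>': "0 < \<eta>'"
  shows "real (card (irregular j k)) \<le> \<rho> * M i i"
proof -
  have jk: "j \<in> {i..m}" "k \<in> {i..m}" "i \<in> {i..m}" using adj_verts[OF j(3)] j i by auto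
  have dense_le_sparse: "8 * K ^ 3 * sqrt \<eta> * M i i \<le> 17 * K ^ 3 * sqrt (sqrt \<eta>) * M i i"
  proof -
    have "sqrt \<eta> \<le> 1" using \<eta> by simp
    then have "sqrt \<eta> \<le> sqrt (sqrt \<eta>)" using \<eta> by (intro real_le_rsqrt) (simp add: power2_eq_square mult_left_le)
    then show ?thesis using K M_nonneg \<eta> by (intro mult_right_mono mult_mono) auto
  qed
  \<comment> \<open>Adjacency of i and j alone gives the pair jumbledness of order
    \<open>\<eta> * p * p\<close>, whether or not k is adjacent to i.\<close>
  have pair: "regular_sparse_pair (C j) (C k) W p K (M i j) (M i k) (\<eta> * q * sqrt (n j * n k)) E (d j k) \<eta>"
    if "j \<in> {i..m}" "k \<in> {i..m}" "i < j" "i < k" "adj H j k" "adj H i j" for j k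
    using that state_finite state_card state_jumbled state_cut jumbledness_path[of j k] p K EW d \<eta>
    by unfold_locales auto
  have one: "real (card {z \<in> C i. \<not> cut_bounded (\<lambda>x y. of_bool (E x y) - d j k * p)
      (\<eta>' * p * (p * M i j) * M i k) {x \<in> C j. W x z} (C k)}) \<le> \<rho> * M i i"
    if "j \<in> {i..m}" "k \<in> {i..m}" "i < j" "i < k" "adj H j k" "adj H i j" for j k
  proof -
    interpret regular_sparse_pair "C j" "C k" W p K "M i j" "M i k" "\<eta> * q * sqrt (n j * n k)" E "d j k" \<eta>
      using that by (rule pair)
    have "\<eta>' * real (card {z \<in> C i. \<not> cut_bounded (\<lambda>x y. of_bool (E x y) - d j k * p)
      (\<eta>' * p * (p * M i j) * M i k) {x \<in> C j. W x z} (C k)}) \<le> 8 * K ^ 3 * sqrt \<eta> * M i i"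
      using jk that state_finite state_card state_jumbled[of j i] jumbledness_nonneg jumbledness_path[of j i]
      by (intro one_sided_inheritance[where b' = "\<eta> * q * sqrt (n j * n i)"]) (auto simp: adj_commute[of H j i])
    also note dense_le_sparse
    finally show ?thesis by (intro \<eta>'_card_le \<eta>')
  qed
  show ?thesis
  proof (cases "adj H i j")
    case ij: True
    show ?thesis
    proof (cases "adj H i k")
      case ik: True
      interpret regular_sparse_pair "C j" "C k" W p K "M i j" "M i k" "\<eta> * q * sqrt (n j * n k)" E "d j k" \<eta>
        using jk j ij by (intro pair)
      have "\<eta>' * real (card {z \<in> C i. \<not> cut_bounded (\<lambda>x y. of_bool (E x y) - d j k * p)
        (\<eta>' * p * (p * M i j) * (p * M i k)) {x \<in> C j. W x z} {y \<in> C k. W y z}}) \<le> 17 * K ^ 3 * sqrt (sqrt \<eta>) * M i i"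
        using jk state_finite state_card state_jumbled[of j i] state_jumbled[of k i] jumbledness_nonneg j ij ik
          jumbledness_triangle[of j k] jumbledness_triangle[of k j] adj_commute[of H]
        by (intro two_sided_inheritance[where ?b1.0 = "\<eta> * q * sqrt (n j * n i)" and ?b2.0 = "\<eta> * q * sqrt (n k * n i)"]) auto
      then show ?thesis using ij ik by (intro \<eta>'_card_le \<eta>') (simp add: irregular_def M_Suc)
    next
      case False
      then show ?thesis using one[OF jk(1,2) j ij] ij by (simp add: irregular_def M_Suc)
    qed
  next
    case ij: False
    show ?thesis
    proof (cases "adj H i k")
      case ik: True
      \<comment> \<open>j and k exchange roles; E, d and the cut bound are symmetric.\<close>
      have "irregular j k = {z \<in> C i. \<not> cut_bounded (\<lambda>x y. of_bool (E x y) - d k j * p)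
        (\<eta>' * p * (p * M i k) * M i j) {x \<in> C k. W x z} (C j)}"
        using ij ik
        by (auto simp: irregular_def M_Suc d_sym[of j k] E_sym mult_ac dest: cut_bounded_swap)
      then show ?thesis using one[of k j] jk j ik by (simp add: adj_commute)
    next
      case False
      \<comment> \<open>Neither candidate set nor scale changes here, so
        \<open>\<eta> \<le> \<eta>'\<close> is enough.\<close>
      have "\<eta> * p * M i j * M i k \<le> \<eta>' * p * M i j * M i k"
        using \<eta> p M_nonneg by (intro mult_right_mono) auto
      then have "irregular j k = {}"
        using state_cut[OF j(3)] j ij False by (auto simp: irregular_def M_Suc intro: cut_bounded_mono)
      then show ?thesis using \<rho> M_nonneg by simp
    qed
  qed
qed

section \<open>Exceptional vertices of one step, and the state after a good one\<close>

definition bad :: "'v set" where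
  "bad = (\<Union>j\<in>{j\<in>{i<..m}. adj H i j}. low_degree j \<union> high_degree j) \<union>
    (\<Union>(j, k)\<in>{(j, k)\<in>{i<..m} \<times> {i<..m}. adj H j k}. irregular j k)"

lemma bad_subset: "bad \<subseteq> C i"
  unfolding bad_def low_degree_def high_degree_def irregular_def by auto

lemma card_bad:
  assumes \<eta>': "0 < \<eta>'"
  shows "real (card bad) \<le> (2 * m + m * m) * \<rho> * M i i"
proof -
  define J where "J = {j\<in>{i<..m}. adj H i j}"
  define I where "I = {(j, k)\<in>{i<..m} \<times> {i<..m}. adj H j k}"
  have finJ: "finite J" and finI: "finite I"
    unfolding J_def I_def by (auto intro: finite_subset[of _ "{i<..m} \<times> {i<..m}"])
  have "card J \<le> card {i<..m}" unfolding J_def by (rule card_mono) auto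
  then have cJ: "card J \<le> m" by simp
  have "card I \<le> card ({i<..m} \<times> {i<..m})" unfolding I_def by (rule card_mono) auto
  also have "\<dots> \<le> m * m" by (simp add: card_cartesian_product mult_le_mono)
  finally have cI: "card I \<le> m * m" .
  define R where "R = \<rho> * M i i"
  have R: "0 \<le> R" unfolding R_def using \<rho> M_nonneg by simp
  have "card bad \<le> card (\<Union>j\<in>J. low_degree j \<union> high_degree j) + card (\<Union>(j, k)\<in>I. irregular j k)"
    unfolding bad_def J_def I_def by (rule card_Un_le)
  also have "\<dots> \<le> (\<Sum>j\<in>J. card (low_degree j \<union> high_degree j)) + (\<Sum>s\<in>I. card (case s of (j, k) \<Rightarrow> irregular j k))"
    by (intro add_mono card_UN_le finJ finI)
  finally have "real (card bad) \<le> (\<Sum>j\<in>J. real (card (low_degree j \<union> high_degree j)))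
      + (\<Sum>s\<in>I. real (card (case s of (j, k) \<Rightarrow> irregular j k)))"
    by (simp flip: of_nat_sum of_nat_add)
  also have "\<dots> \<le> (\<Sum>j\<in>J. 2 * R) + (\<Sum>s\<in>I. R)"
  proof (intro add_mono sum_mono)
    fix j assume "j \<in> J"
    then have "real (card (low_degree j)) \<le> R" "real (card (high_degree j)) \<le> R"
      unfolding R_def J_def by (auto intro: card_low_degree card_high_degree)
    moreover have "card (low_degree j \<union> high_degree j) \<le> card (low_degree j) + card (high_degree j)" by (rule card_Un_le)
    ultimately show "real (card (low_degree j \<union> high_degree j)) \<le> 2 * R" by linarith
  next
    fix s assume "s \<in> I"
    then show "real (card (case s of (j, k) \<Rightarrow> irregular j k)) \<le> R"
      unfolding R_def I_def by (auto intro: card_irregular \<eta>')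
  qed
  also have "\<dots> = real (2 * card J + card I) * R" by (simp add: algebra_simps)
  also have "\<dots> \<le> real (2 * m + m * m) * R" using cJ cI R by (intro mult_right_mono) (simp_all only: of_nat_le_iff)
  finally show ?thesis unfolding R_def by (simp add: mult.assoc)
qed

lemma good_vertex:
  assumes z: "z \<in> C i - bad"
  shows "regular_state (Suc i) (K + 1) \<eta>' (candidates_after H E i C z)"
    and "j \<in> {Suc i..m} \<Longrightarrow> (if adj H i j then d i j * p * real (card (C j)) else real (card (C j)))
      - \<theta> * M (Suc i) j \<le> real (card (candidates_after H E i C z j))"
proof -
  have deg: "real (card (candidates_after H E i C z j)) = (\<Sum>v\<in>C j. of_bool (E z v))"
    if "j \<in> {i..m}" "adj H i j" for j
    unfolding candidates_after_def using that state_finite[of j]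
    by (simp add: real_card_filter E_sym[of _ z])
  show "(if adj H i j then d i j * p * real (card (C j)) else real (card (C j))) - \<theta> * M (Suc i) j
      \<le> real (card (candidates_after H E i C z j))" if "j \<in> {Suc i..m}"
  proof (cases "adj H i j")
    case True
    then have "z \<notin> low_degree j" using z that unfolding bad_def by auto
    then show ?thesis using True z that deg[of j] by (auto simp: low_degree_def M_Suc mult_ac)
  next
    case False
    then show ?thesis using \<theta> M_nonneg by (simp add: candidates_after_def)
  qed
  show "regular_state (Suc i) (K + 1) \<eta>' (candidates_after H E i C z)"
    unfolding regular_state_def
  proof (intro conjI ballI impI)
    fix j assume j: "j \<in> {Suc i..m}"
    then have j': "j \<in> {i..m}" by auto
    show "finite (candidates_after H E i C z j)" using state_finite[OF j'] by (simp add: candidates_after_def)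
    show "real (card (candidates_after H E i C z j)) \<le> (K + 1) * M (Suc i) j"
    proof (cases "adj H i j")
      case True
      then have "z \<notin> high_degree j" using z j unfolding bad_def by auto
      then have "(\<Sum>v\<in>C j. of_bool (W z v)) \<le> (K + 1) * p * M i j" using z by (auto simp: high_degree_def)
      moreover have "(\<Sum>v\<in>C j. of_bool (E z v) :: real) \<le> (\<Sum>v\<in>C j. of_bool (W z v))"
        using EW by (intro sum_mono) (auto simp: of_bool_def)
      ultimately show ?thesis using True deg[OF j' True] by (simp add: M_Suc mult.assoc)
    next
      case False
      then show ?thesis using state_card[OF j'] M_nonneg[of i j] by (simp add: candidates_after_def M_Suc algebra_simps)
    qed
  next
    fix j k assume jk: "j \<in> {Suc i..m}" "k \<in> {Suc i..m}" "adj H j k"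
    have sub: "candidates_after H E i C z j \<subseteq> C j" for j by (auto simp: candidates_after_def)
    have "\<eta> * q * sqrt (n j * n k) \<le> \<eta>' * q * sqrt (n j * n k)"
      using \<eta> q n by (intro mult_right_mono) auto
    with state_jumbled[OF jk(3)] jk
    show "jumbled W p (\<eta>' * q * sqrt (n j * n k)) (candidates_after H E i C z j) (candidates_after H E i C z k)"
      by (intro jumbled_subset[OF jumbled_mono sub sub]) auto
    \<comment> \<open>Irregularity was measured on W-neighbourhoods, where jumbledness is available.
      The candidates are E-neighbourhoods, hence subsets, and the cut bound restricts to
      them.\<close>
    have "z \<notin> irregular j k" using z jk unfolding bad_def by auto
    then have "cut_bounded (\<lambda>x y. of_bool (E x y) - d j k * p) (\<eta>' * p * M (Suc i) j * M (Suc i) k)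
      {x \<in> C j. adj H i j \<longrightarrow> W x z} {y \<in> C k. adj H i k \<longrightarrow> W y z}"
      using z by (auto simp: irregular_def)
    then show "cut_bounded (\<lambda>x y. of_bool (E x y) - d j k * p) (\<eta>' * p * M (Suc i) j * M (Suc i) k)
        (candidates_after H E i C z j) (candidates_after H E i C z k)"
      by (rule cut_bounded_subset) (auto simp: candidates_after_def EW)
  qed
qed

end

end

section \<open>Counting partial copies\<close>

text \<open>Factors are exchanged one at a time: an exchange loses at most
  \<open>\<theta> * u j\<close>, and the remaining factors are at most L times their scale. A
  uniform power of L is used, as \<open>1 \<le> L\<close>.\<close>

lemma prod_lower_bound:
  fixes a b u :: "'i \<Rightarrow> real"
  assumes "finite A" and "\<And>j. j \<in> A \<Longrightarrow> 0 \<le> a j \<and> 0 \<le> b j \<and> 0 \<le> u j \<and> b j \<le> L * u j \<and> b j - \<theta> * u j \<le> a j"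
    and L: "1 \<le> L" and \<theta>: "0 \<le> \<theta>"
  shows "(\<Prod>j\<in>A. b j) - real (card A) * \<theta> * L ^ card A * (\<Prod>j\<in>A. u j) \<le> (\<Prod>j\<in>A. a j)"
  using assms(1,2)
proof (induction A)
  case (insert x A)
  define Pa where "Pa = (\<Prod>j\<in>A. a j)"
  define Pb where "Pb = (\<Prod>j\<in>A. b j)"
  define Pu where "Pu = (\<Prod>j\<in>A. u j)"
  define k where "k = card A"
  define E where "E = real k * \<theta> * L ^ k * Pu"
  have x: "0 \<le> a x" "0 \<le> b x" "0 \<le> u x" "b x \<le> L * u x" "b x - \<theta> * u x \<le> a x"
    using insert.prems by auto
  have P: "0 \<le> Pa" "0 \<le> Pb" "0 \<le> Pu"
    unfolding Pa_def Pb_def Pu_def using insert.prems by (auto intro: prod_nonneg)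
  have E0: "0 \<le> E" unfolding E_def using \<theta> L P by simp
  have "Pb \<le> (\<Prod>j\<in>A. L * u j)" unfolding Pb_def using insert.prems by (intro prod_mono) auto
  then have Pb: "Pb \<le> L ^ k * Pu" unfolding Pu_def k_def by (simp add: prod.distrib)
  have IH: "Pb - E \<le> Pa" unfolding Pa_def Pb_def Pu_def E_def k_def using insert by auto
  have LL: "L ^ k * Pu \<le> L ^ Suc k * Pu" using L P by (intro mult_right_mono power_increasing) auto
  have err: "\<theta> * u x * Pb + b x * E \<le> real (Suc k) * \<theta> * L ^ Suc k * (u x * Pu)"
  proof -
    have "\<theta> * u x * Pb \<le> \<theta> * u x * (L ^ Suc k * Pu)"
      using order_trans[OF Pb LL] \<theta> x by (intro mult_left_mono) auto
    moreover have "b x * E \<le> (L * u x) * E" using x E0 by (intro mult_right_mono) auto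
    ultimately show ?thesis unfolding E_def by (simp add: algebra_simps)
  qed
  have "b x * Pb - (\<theta> * u x * Pb + b x * E) \<le> a x * Pa"
  \<comment> \<open>Lower bounds can be multiplied only when they are nonnegative. If one of them is
    not, the left-hand side is already at most 0.\<close>
  proof (cases "b x - \<theta> * u x \<le> 0 \<or> Pb - E \<le> 0")
    case True
    then have "b x * Pb \<le> \<theta> * u x * Pb \<or> b x * Pb \<le> b x * E"
      using x P by (auto intro: mult_right_mono mult_left_mono)
    moreover have "0 \<le> \<theta> * u x * Pb" "0 \<le> b x * E" "0 \<le> a x * Pa" using x P E0 \<theta> by simp_all
    ultimately show ?thesis by linarith
  next
    case False
    then have "(b x - \<theta> * u x) * (Pb - E) \<le> a x * Pa" using x IH by (intro mult_mono) auto
    moreover have "0 \<le> \<theta> * u x * E" using \<theta> x E0 by simp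
    ultimately show ?thesis by (simp add: algebra_simps)
  qed
  then have "b x * Pb - real (Suc k) * \<theta> * L ^ Suc k * (u x * Pu) \<le> a x * Pa" using err by linarith
  then show ?case using insert.hyps unfolding Pa_def Pb_def Pu_def k_def by simp
qed simp

lemma exists_small_parameter:
  fixes K \<eta>' \<theta> \<rho> :: real
  assumes "1 \<le> K" "0 < \<eta>'" "0 < \<theta>" "0 < \<rho>"
  shows "\<exists>\<eta>>0. \<eta> \<le> 1 \<and> \<eta> \<le> \<eta>' \<and> \<eta> \<le> \<theta> * \<rho> \<and> \<eta> * K \<le> \<rho> \<and> 17 * K ^ 3 * sqrt (sqrt \<eta>) \<le> \<eta>' * \<rho>"
proof -
  define x where "x = \<eta>' * \<rho> / (17 * K ^ 3)"
  \<comment> \<open>The fourth power undoes the two nested square roots.\<close>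
  define \<eta> where "\<eta> = Min {1, \<eta>', \<theta> * \<rho>, \<rho> / K, x ^ 4}"
  have x: "0 < x" unfolding x_def using assms by simp
  then have pos: "0 < \<eta>" unfolding \<eta>_def using assms by simp
  have le: "\<eta> \<le> 1" "\<eta> \<le> \<eta>'" "\<eta> \<le> \<theta> * \<rho>" "\<eta> \<le> \<rho> / K" "\<eta> \<le> x ^ 4"
    unfolding \<eta>_def by (auto intro!: Min_le)
  have "sqrt (sqrt \<eta>) \<le> sqrt (sqrt ((x\<^sup>2)\<^sup>2))" using le(5) by simp
  also have "\<dots> = x" using x by (simp only: real_sqrt_abs abs_power2 abs_of_pos)
  finally have "17 * K ^ 3 * sqrt (sqrt \<eta>) \<le> 17 * K ^ 3 * x" using assms by (intro mult_left_mono) auto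
  also have "\<dots> = \<eta>' * \<rho>" unfolding x_def using assms by simp
  finally have "17 * K ^ 3 * sqrt (sqrt \<eta>) \<le> \<eta>' * \<rho>" .
  moreover have "\<eta> * K \<le> \<rho>" using le(4) assms by (simp add: pos_le_divide_eq)
  ultimately show ?thesis using pos le by blast
qed

section \<open>Splitting off the edges at vertex i\<close>

lemma finite_forward_edges:
  assumes "simple_graph H" "verts H = {1..m}"
  shows "finite (forward_edges H i)"
proof (rule finite_subset)
  show "forward_edges H i \<subseteq> {1..m} \<times> {1..m}"
    using adj_in_verts[OF assms] unfolding forward_edges_def by blast
qed simp

lemma forward_edges_Suc:
  assumes "simple_graph H" "verts H = {1..m}"
  shows "forward_edges H i = Pair i ` {k\<in>{Suc i..m}. adj H i k} \<union> forward_edges H (Suc i)"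
proof -
  have "(j, k) \<in> forward_edges H i \<longleftrightarrow>
      (j, k) \<in> Pair i ` {k\<in>{Suc i..m}. adj H i k} \<union> forward_edges H (Suc i)" for j k
    using adj_in_verts[OF assms, of j k] by (cases "j = i") (auto simp: forward_edges_def)
  then show ?thesis by (simp only: set_eq_iff split_paired_All) blast
qed

lemma Pair_Int_forward_edges: "Pair i ` A \<inter> forward_edges H (Suc i) = {}"
  by (auto simp: forward_edges_def)

lemma forward_edges_Suc_m:
  assumes "simple_graph H" "verts H = {1..m}"
  shows "forward_edges H (Suc m) = {}"
proof -
  have "(j, k) \<notin> forward_edges H (Suc m)" for j k
    using adj_in_verts[OF assms, of j k] by (auto simp: forward_edges_def)
  then show ?thesis by (metis equals0I surj_pair)
qed

lemma prod_forward_edges_Suc: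
  fixes g :: "nat \<Rightarrow> nat \<Rightarrow> real"
  assumes "simple_graph H" "verts H = {1..m}"
  shows "(\<Prod>(j, k)\<in>forward_edges H i. g j k)
    = (\<Prod>k\<in>{k\<in>{Suc i..m}. adj H i k}. g i k) * (\<Prod>(j, k)\<in>forward_edges H (Suc i). g j k)"
  unfolding forward_edges_Suc[OF assms, of i]
  by (subst prod.union_disjoint)
    (simp_all add: Pair_Int_forward_edges finite_forward_edges[OF assms] prod.reindex inj_on_def)

lemma card_forward_edges_Suc:
  assumes "simple_graph H" "verts H = {1..m}"
  shows "card (forward_edges H i) = card {k\<in>{Suc i..m}. adj H i k} + card (forward_edges H (Suc i))"
  unfolding forward_edges_Suc[OF assms, of i]
  by (subst card_Un_disjoint)
    (simp_all add: Pair_Int_forward_edges finite_forward_edges[OF assms] card_image inj_on_def)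

text \<open>Extending a partial copy by z at i is injective. Only this inequality is asked for
  because exceptional z are simply discarded.\<close>

lemma sum_partial_copies_le:
  assumes fin: "\<And>j. j \<in> {i..m} \<Longrightarrow> finite (C j)" and i: "i \<le> m" and G: "G \<subseteq> C i"
    and sym: "\<And>x y. E x y \<longleftrightarrow> E y x" and irrefl: "\<not> adj H i i"
  shows "(\<Sum>z\<in>G. card (partial_copies H m E (Suc i) (candidates_after H E i C z)))
    \<le> card (partial_copies H m E i C)"
proof -
  define F where "F z = partial_copies H m E (Suc i) (candidates_after H E i C z)" for z
  have finG: "finite G" using G fin[of i] i finite_subset by auto
  have finF: "finite (F z)" for z
  proof -
    have "finite (\<Pi>\<^sub>E j\<in>{Suc i..m}. candidates_after H E i C z j)"
      using fin by (intro finite_PiE) (auto simp: candidates_after_def)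
    then show ?thesis unfolding F_def partial_copies_def by simp
  qed
  have fin_copies: "finite (partial_copies H m E i C)"
  proof -
    have "finite (\<Pi>\<^sub>E j\<in>{i..m}. C j)" using fin by (intro finite_PiE) auto
    then show ?thesis unfolding partial_copies_def by simp
  qed
  \<comment> \<open>The default value at i makes injectivity work: overwriting it by z loses no
    information about \<open>\<psi>\<close>.\<close>
  have undef: "\<psi> i = undefined" if "\<psi> \<in> F z" for \<psi> z
    using that unfolding F_def partial_copies_def by (auto simp: PiE_def extensional_def)
  have "(\<Sum>z\<in>G. card (F z)) = card (SIGMA z:G. F z)" using finG finF by simp
  also have "\<dots> \<le> card (partial_copies H m E i C)"
  proof (rule card_inj_on_le[OF _ _ fin_copies])
    show "inj_on (\<lambda>(z, \<psi>). \<psi>(i := z)) (SIGMA z:G. F z)"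
    proof (rule inj_onI, clarsimp)
      fix z \<psi> z' \<psi>' assume *: "\<psi> \<in> F z" "\<psi>' \<in> F z'" "\<psi>(i := z) = \<psi>'(i := z')"
      have "z = z'" using fun_cong[OF *(3), of i] by simp
      moreover have "\<psi> k = \<psi>' k" for k
        using fun_cong[OF *(3), of k] undef[OF *(1)] undef[OF *(2)] by (cases "k = i") auto
      ultimately show "z = z' \<and> \<psi> = \<psi>'" by auto
    qed
    show "(\<lambda>(z, \<psi>). \<psi>(i := z)) ` (SIGMA z:G. F z) \<subseteq> partial_copies H m E i C"
    proof clarsimp
      fix z \<psi> assume z: "z \<in> G" and \<psi>: "\<psi> \<in> F z"
      have \<psi>_in: "\<psi> j \<in> candidates_after H E i C z j" if "j \<in> {Suc i..m}" for j
        using \<psi> that unfolding F_def partial_copies_def by auto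
      have \<psi>_adj: "E (\<psi> j) (\<psi> k)" if "j \<in> {Suc i..m}" "k \<in> {Suc i..m}" "adj H j k" for j k
        using \<psi> that unfolding F_def partial_copies_def by auto
      have \<psi>_out: "\<psi> j = undefined" if "j \<notin> {Suc i..m}" for j
        using \<psi> that unfolding F_def partial_copies_def by (auto simp: PiE_def extensional_def)
      have "\<psi>(i := z) \<in> (\<Pi>\<^sub>E j\<in>{i..m}. C j)"
      proof (rule PiE_I)
        fix j assume "j \<in> {i..m}"
        then show "(\<psi>(i := z)) j \<in> C j"
          using z G \<psi>_in[of j] by (cases "j = i") (auto simp: candidates_after_def)
      next
        fix j assume "j \<notin> {i..m}"
        then show "(\<psi>(i := z)) j = undefined" using \<psi>_out[of j] i by auto
      qed
      moreover have "E ((\<psi>(i := z)) j) ((\<psi>(i := z)) k)" if "j \<in> {i..m}" "k \<in> {i..m}" "adj H j k" for j k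
      proof -
        have split: "j = i \<or> j \<in> {Suc i..m}" "k = i \<or> k \<in> {Suc i..m}" using that by auto
        consider "j = i" "k = i" | "j = i" "k \<in> {Suc i..m}" | "j \<in> {Suc i..m}" "k = i" | "j \<in> {Suc i..m}" "k \<in> {Suc i..m}"
          using split by blast
        then show ?thesis
        proof cases
          case 1
          then show ?thesis using irrefl that by simp
        next
          case 2
          then show ?thesis using \<psi>_in[of k] that sym by (auto simp: candidates_after_def)
        next
          case 3
          then show ?thesis using \<psi>_in[of j] that adj_commute[of H] by (auto simp: candidates_after_def)
        next
          case 4
          then show ?thesis using \<psi>_adj that by auto
        qed
      qed
      ultimately show "\<psi>(i := z) \<in> partial_copies H m E i C" unfolding partial_copies_def by blast
    qed
  qed
  finally show ?thesis unfolding F_def .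
qed

text \<open>\<open>\<eta>\<close> is chosen before p, the graphs and the sets, as the theorem
  requires. K and \<open>\<gamma>\<close> vary in the induction: a step calls the hypothesis with
  \<open>K + 1\<close> and a smaller error. The main term uses actual sizes and the error uses
  scales, so nothing is lost when densities vanish.\<close>

lemma partial_copies_lower_bound:
  fixes H :: "nat ugraph"
  assumes H: "simple_graph H" "verts H = {1..m}" and i: "1 \<le> i" "i \<le> Suc m"
    and "1 \<le> K" "0 < \<gamma>"
  shows "\<exists>\<eta>>0. \<eta> \<le> 1 \<and> (\<forall>p q (E :: 'v \<Rightarrow> 'v \<Rightarrow> bool) W n d C.
    counting_frame H m p q E W n d \<longrightarrow> counting_frame.regular_state H m p q E W n d i K \<eta> C \<longrightarrow>
    (\<Prod>(j, k)\<in>forward_edges H i. d j k * p) * (\<Prod>j\<in>{i..m}. real (card (C j)))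
      - \<gamma> * p ^ card (forward_edges H i) * (\<Prod>j\<in>{i..m}. scale H p n i j)
    \<le> real (card (partial_copies H m E i C)))"
  using i(2,1) assms(5,6)
proof (induction i arbitrary: K \<gamma> rule: inc_induct)
  case base
  \<comment> \<open>No vertex is left: there is one empty partial copy, and all products are
    1.\<close>
  show ?case
    using base by (intro exI[of _ 1]) (auto simp: forward_edges_Suc_m[OF H] partial_copies_def)
next
  case (step i K \<gamma>)
  define e' where "e' = card (forward_edges H (Suc i))"
  \<comment> \<open>L bounds a predicted candidate set against its scale (density at most 2, size at
    most K times the scale), \<open>\<Lambda>\<close> bounds the whole predicted count, and D counts
    the kinds of exceptional vertices. The other three parameters make the errors from set sizes,
    from the induction hypothesis and from exceptional vertices at most \<open>\<gamma> / 4\<close>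
    each; the added 1 keeps denominators positive.\<close>
  define L where "L = 2 * K"
  define s where "s = card {Suc i..m}"
  define \<Lambda> where "\<Lambda> = 2 ^ e' * L ^ s"
  define D where "D = real (2 * m + m * m)"
  define \<gamma>' where "\<gamma>' = \<gamma> / (4 * K)"
  define \<theta> where "\<theta> = \<gamma> / (4 * K * (\<Lambda> * s + 1))"
  define \<rho> where "\<rho> = \<gamma> / (4 * (D * \<Lambda> + 1))"
  have K: "1 \<le> K" and \<gamma>: "0 < \<gamma>" and i: "i \<in> {1..m}" using step by auto
  have L: "1 \<le> L" unfolding L_def using K by simp
  have \<Lambda>: "0 < \<Lambda>" unfolding \<Lambda>_def using L by simp
  have D: "0 \<le> D" unfolding D_def by simp
  have D\<Lambda>: "0 < D * \<Lambda> + 1" using D \<Lambda> by (simp add: add_nonneg_pos)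
  have \<Lambda>s: "0 < \<Lambda> * s + 1" using \<Lambda> by (simp add: add_nonneg_pos)
  have pos: "0 < \<gamma>'" "0 < \<theta>" "0 < \<rho>"
    unfolding \<gamma>'_def \<theta>_def \<rho>_def using K \<gamma> D\<Lambda> \<Lambda>s by simp_all
  have total: "K * (\<Lambda> * s * \<theta> + \<gamma>') + D * \<rho> * \<Lambda> \<le> \<gamma>"
  proof -
    have "K * (\<Lambda> * s * \<theta>) = \<gamma> / 4 * (\<Lambda> * s / (\<Lambda> * s + 1))"
      unfolding \<theta>_def using K by simp
    also have "\<dots> \<le> \<gamma> / 4 * 1" using \<gamma> \<Lambda>s by (intro mult_left_mono) auto
    finally have 1: "K * (\<Lambda> * s * \<theta>) \<le> \<gamma> / 4" by simp
    have "D * \<rho> * \<Lambda> = \<gamma> / 4 * (D * \<Lambda> / (D * \<Lambda> + 1))" unfolding \<rho>_def by simp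
    also have "\<dots> \<le> \<gamma> / 4 * 1" using \<gamma> D\<Lambda> by (intro mult_left_mono) auto
    finally have 2: "D * \<rho> * \<Lambda> \<le> \<gamma> / 4" by simp
    have 3: "K * \<gamma>' = \<gamma> / 4" unfolding \<gamma>'_def using K by simp
    show ?thesis using 1 2 3 \<gamma> by (simp add: distrib_left)
  qed
  obtain \<eta>' where \<eta>': "0 < \<eta>'" and IH: "\<And>p q (E :: 'v \<Rightarrow> 'v \<Rightarrow> bool) W n d C.
    counting_frame H m p q E W n d \<Longrightarrow> counting_frame.regular_state H m p q E W n d (Suc i) (K + 1) \<eta>' C \<Longrightarrow>
    (\<Prod>(j, k)\<in>forward_edges H (Suc i). d j k * p) * (\<Prod>j\<in>{Suc i..m}. real (card (C j)))
      - \<gamma>' * p ^ e' * (\<Prod>j\<in>{Suc i..m}. scale H p n (Suc i) j)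
    \<le> real (card (partial_copies H m E (Suc i) C))"
    using step.IH[of "K + 1" \<gamma>'] K pos unfolding e'_def by auto
  obtain \<eta> where \<eta>: "0 < \<eta>" "\<eta> \<le> 1" "\<eta> \<le> \<eta>'" "\<eta> \<le> \<theta> * \<rho>" "\<eta> * K \<le> \<rho>" "17 * K ^ 3 * sqrt (sqrt \<eta>) \<le> \<eta>' * \<rho>"
    using exists_small_parameter[OF K \<eta>' pos(2,3)] by blast
  show ?case
  proof (intro exI[of _ \<eta>] conjI allI impI \<eta>)
    fix p q :: real and E W :: "'v \<Rightarrow> 'v \<Rightarrow> bool" and n d C
    assume fr: "counting_frame H m p q E W n d"
      and st: "counting_frame.regular_state H m p q E W n d i K \<eta> C"
    interpret counting_frame H m p q E W n d by (rule fr)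
    note ctx = st i K order_less_imp_le[OF \<eta>(1)] \<eta>(2,3) order_less_imp_le[OF pos(3)] pos(2) \<eta>(4-6)
    define T where "T = bad i K \<eta>' \<theta> C"
    define P0 where "P0 = p ^ card (forward_edges H i) * (\<Prod>j\<in>{Suc i..m}. M i j)"
    define R where "R = (\<Prod>(j, k)\<in>forward_edges H (Suc i). d j k * p)"
    \<comment> \<open>The size predicted for the candidates of j after a good choice. The factors d
      * p collected here are those of the edges at i, which is why the main term becomes
      \<open>c * Q\<close>.\<close>
    define B where "B j = (if adj H i j then d i j * p * real (card (C j)) else real (card (C j)))" for j
    define Q where "Q = R * (\<Prod>j\<in>{Suc i..m}. B j)"
    define c where "c = real (card (C i))"
    have fin: "finite (C j)" and card_C: "real (card (C j)) \<le> K * M i j" if "j \<in> {i..m}" for j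
      using st that unfolding regular_state_def by auto
    have M_prod: "(\<Prod>j\<in>{Suc i..m}. M (Suc i) j)
        = p ^ card {k\<in>{Suc i..m}. adj H i k} * (\<Prod>j\<in>{Suc i..m}. M i j)"
    proof -
      have "(\<Prod>j\<in>{Suc i..m}. M (Suc i) j) = (\<Prod>j\<in>{Suc i..m}. (if adj H i j then p else 1) * M i j)"
        by (intro prod.cong) (auto simp: M_Suc)
      also have "\<dots> = (\<Prod>j\<in>{Suc i..m}. if adj H i j then p else 1) * (\<Prod>j\<in>{Suc i..m}. M i j)"
        by (rule prod.distrib)
      also have "(\<Prod>j\<in>{Suc i..m}. if adj H i j then p else 1) = p ^ card {k\<in>{Suc i..m}. adj H i k}"
        by (subst prod.inter_filter[symmetric]) auto
      finally show ?thesis .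
    qed
    have P0: "P0 = p ^ e' * (\<Prod>j\<in>{Suc i..m}. M (Suc i) j)"
      unfolding P0_def M_prod e'_def card_forward_edges_Suc[OF H, of i] by (simp add: power_add)
    have P0_nonneg: "0 \<le> P0" unfolding P0_def using p M_nonneg by (simp add: prod_nonneg)
    have R: "0 \<le> R" "R \<le> 2 ^ e' * p ^ e'"
    proof -
      have *: "0 \<le> d j k * p \<and> d j k * p \<le> 2 * p" if "(j, k) \<in> forward_edges H (Suc i)" for j k
        using that d[of j k] p by (auto simp: forward_edges_def)
      show "0 \<le> R" unfolding R_def using * by (intro prod_nonneg) auto
      have "R \<le> (\<Prod>(j, k)\<in>forward_edges H (Suc i). 2 * p)"
        unfolding R_def using * by (intro prod_mono) auto
      then show "R \<le> 2 ^ e' * p ^ e'" by (simp add: e'_def case_prod_unfold power_mult_distrib)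
    qed
    have B: "0 \<le> B j" "B j \<le> L * M (Suc i) j" if j: "j \<in> {Suc i..m}" for j
    proof -
      show "0 \<le> B j" unfolding B_def using d p by simp
      show "B j \<le> L * M (Suc i) j"
      proof (cases "adj H i j")
        case True
        have "d i j * p * real (card (C j)) \<le> 2 * p * (K * M i j)"
          using d[OF True] p card_C[of j] j K M_nonneg by (intro mult_mono) auto
        then show ?thesis using True by (simp add: B_def L_def M_Suc mult_ac)
      next
        case False
        have "real (card (C j)) \<le> K * M i j" using card_C[of j] j by simp
        also have "\<dots> \<le> 2 * K * M i j" using K M_nonneg by (intro mult_right_mono) auto
        finally show ?thesis using False by (simp add: B_def L_def M_Suc)
      qed
    qed
    have Q0: "0 \<le> Q" unfolding Q_def using R B by (intro mult_nonneg_nonneg prod_nonneg) auto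
    have Q_le: "Q \<le> \<Lambda> * P0"
    proof -
      have "(\<Prod>j\<in>{Suc i..m}. B j) \<le> (\<Prod>j\<in>{Suc i..m}. L * M (Suc i) j)"
        using B by (intro prod_mono) auto
      also have "\<dots> = L ^ s * (\<Prod>j\<in>{Suc i..m}. M (Suc i) j)" by (simp add: prod.distrib s_def)
      finally have "Q \<le> (2 ^ e' * p ^ e') * (L ^ s * (\<Prod>j\<in>{Suc i..m}. M (Suc i) j))"
        unfolding Q_def using R p B by (intro mult_mono prod_nonneg) auto
      then show ?thesis unfolding P0 \<Lambda>_def by (simp add: mult_ac)
    qed
    have cQ: "(\<Prod>(j, k)\<in>forward_edges H i. d j k * p) * (\<Prod>j\<in>{i..m}. real (card (C j))) = c * Q"
    proof -
      have "(\<Prod>j\<in>{Suc i..m}. B j)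
          = (\<Prod>j\<in>{Suc i..m}. (if adj H i j then d i j * p else 1) * real (card (C j)))"
        by (intro prod.cong) (auto simp: B_def)
      also have "\<dots> = (\<Prod>j\<in>{Suc i..m}. if adj H i j then d i j * p else 1) * (\<Prod>j\<in>{Suc i..m}. real (card (C j)))"
        by (rule prod.distrib)
      also have "(\<Prod>j\<in>{Suc i..m}. if adj H i j then d i j * p else 1) = (\<Prod>j\<in>{k\<in>{Suc i..m}. adj H i k}. d i j * p)"
        by (rule prod.inter_filter[symmetric]) simp
      finally have prod_B: "(\<Prod>j\<in>{Suc i..m}. B j)
        = (\<Prod>j\<in>{k\<in>{Suc i..m}. adj H i k}. d i j * p) * (\<Prod>j\<in>{Suc i..m}. real (card (C j)))" .
      have "{i..m} = insert i {Suc i..m}" using i by auto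
      then have "(\<Prod>j\<in>{i..m}. real (card (C j))) = c * (\<Prod>j\<in>{Suc i..m}. real (card (C j)))"
        by (simp add: c_def)
      then show ?thesis
        unfolding Q_def R_def prod_B prod_forward_edges_Suc[OF H, of _ i] by (simp add: mult_ac)
    qed
    have good: "Q - (\<Lambda> * s * \<theta> + \<gamma>') * P0
        \<le> real (card (partial_copies H m E (Suc i) (candidates_after H E i C z)))" if z: "z \<in> C i - T" for z
    proof -
      note good_vertex = good_vertex[OF ctx z[unfolded T_def]]
      have "(\<Prod>j\<in>{Suc i..m}. B j) - real s * \<theta> * L ^ s * (\<Prod>j\<in>{Suc i..m}. M (Suc i) j)
        \<le> (\<Prod>j\<in>{Suc i..m}. real (card (candidates_after H E i C z j)))"
        unfolding s_def using good_vertex(2) B M_nonneg L pos(2)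
        by (intro prod_lower_bound) (auto simp: B_def[abs_def])
      then have "R * ((\<Prod>j\<in>{Suc i..m}. B j) - real s * \<theta> * L ^ s * (\<Prod>j\<in>{Suc i..m}. M (Suc i) j))
        \<le> R * (\<Prod>j\<in>{Suc i..m}. real (card (candidates_after H E i C z j)))"
        using R(1) by (rule mult_left_mono)
      moreover have "R * (real s * \<theta> * L ^ s * (\<Prod>j\<in>{Suc i..m}. M (Suc i) j))
          \<le> (2 ^ e' * p ^ e') * (real s * \<theta> * L ^ s * (\<Prod>j\<in>{Suc i..m}. M (Suc i) j))"
        using R(2) pos(2) L M_nonneg by (intro mult_right_mono mult_nonneg_nonneg prod_nonneg) auto
      moreover have "(2 ^ e' * p ^ e') * (real s * \<theta> * L ^ s * (\<Prod>j\<in>{Suc i..m}. M (Suc i) j)) = \<Lambda> * s * \<theta> * P0"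
        unfolding P0 \<Lambda>_def by (simp add: mult_ac)
      moreover have "\<gamma>' * p ^ e' * (\<Prod>j\<in>{Suc i..m}. M (Suc i) j) = \<gamma>' * P0"
        unfolding P0 by (simp add: mult_ac)
      ultimately show ?thesis
        using IH[OF fr good_vertex(1)] unfolding Q_def R_def[symmetric]
        by (simp only: right_diff_distrib distrib_right)
    qed
    \<comment> \<open>The guaranteed count may be negative. Truncating at 0 keeps it a valid lower
      bound and makes the loss from the discarded set at most \<open>card T * Q\<close>.\<close>
    define V where "V = max 0 (Q - (\<Lambda> * s * \<theta> + \<gamma>') * P0)"
    have V: "0 \<le> V" "V \<le> Q" "Q - (\<Lambda> * s * \<theta> + \<gamma>') * P0 \<le> V"
      unfolding V_def using Q0 \<Lambda> pos P0_nonneg by (auto intro!: mult_nonneg_nonneg)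
    have T_sub: "T \<subseteq> C i" unfolding T_def by (rule bad_subset[OF ctx])
    have T_card: "real (card T) \<le> D * \<rho> * M i i"
      unfolding T_def D_def using card_bad[OF ctx \<eta>'] by simp
    have "c - real (card T) = real (card (C i - T))"
      unfolding c_def using T_sub fin[of i] i card_mono[of "C i" T]
      by (subst card_Diff_subset) (auto intro: finite_subset)
    then have "(c - real (card T)) * V = (\<Sum>z\<in>C i - T. V)" by simp
    also have "\<dots> \<le> (\<Sum>z\<in>C i - T. real (card (partial_copies H m E (Suc i) (candidates_after H E i C z))))"
      unfolding V_def by (intro sum_mono max.boundedI good) auto
    also have "\<dots> = real (\<Sum>z\<in>C i - T. card (partial_copies H m E (Suc i) (candidates_after H E i C z)))" by simp
    also have "\<dots> \<le> real (card (partial_copies H m E i C))"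
      unfolding of_nat_le_iff
      using fin i adj_verts[of i i] by (intro sum_partial_copies_le E_sym) auto
    finally have lower: "(c - real (card T)) * V \<le> real (card (partial_copies H m E i C))" .
    have "c * (Q - (\<Lambda> * s * \<theta> + \<gamma>') * P0) \<le> c * V" using V by (intro mult_left_mono) (auto simp: c_def)
    moreover have "real (card T) * V \<le> (D * \<rho> * M i i) * (\<Lambda> * P0)"
      using T_card V Q_le D pos(3) M_nonneg by (intro mult_mono) auto
    moreover have "c * ((\<Lambda> * s * \<theta> + \<gamma>') * P0) \<le> (K * M i i) * ((\<Lambda> * s * \<theta> + \<gamma>') * P0)"
      using card_C[of i] i \<Lambda> pos P0_nonneg unfolding c_def
      by (intro mult_right_mono mult_nonneg_nonneg add_nonneg_nonneg) auto
    moreover have "(K * M i i) * ((\<Lambda> * s * \<theta> + \<gamma>') * P0) + (D * \<rho> * M i i) * (\<Lambda> * P0) \<le> \<gamma> * (M i i * P0)"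
    proof -
      have "(K * M i i) * ((\<Lambda> * s * \<theta> + \<gamma>') * P0) + (D * \<rho> * M i i) * (\<Lambda> * P0)
        = (K * (\<Lambda> * s * \<theta> + \<gamma>') + D * \<rho> * \<Lambda>) * (M i i * P0)" by (simp add: algebra_simps)
      also have "\<dots> \<le> \<gamma> * (M i i * P0)" using total M_nonneg P0_nonneg by (intro mult_right_mono) auto
      finally show ?thesis .
    qed
    moreover have "(\<Prod>j\<in>{i..m}. M i j) = M i i * (\<Prod>j\<in>{Suc i..m}. M i j)"
    proof -
      have "{i..m} = insert i {Suc i..m}" using i by auto
      then show ?thesis by simp
    qed
    then have "\<gamma> * p ^ card (forward_edges H i) * (\<Prod>j\<in>{i..m}. M i j) = \<gamma> * (M i i * P0)"
      unfolding P0_def by (simp add: mult_ac)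
    ultimately show "(\<Prod>(j, k)\<in>forward_edges H i. d j k * p) * (\<Prod>j\<in>{i..m}. real (card (C j)))
      - \<gamma> * p ^ card (forward_edges H i) * (\<Prod>j\<in>{i..m}. M i j) \<le> real (card (partial_copies H m E i C))"
      unfolding cQ using lower by (simp only: left_diff_distrib right_diff_distrib)
  qed
qed

section \<open>The exponent and the counting lemma\<close>

lemma card_nbrs_below_le:
  assumes "simple_graph H"
  shows "card (nbrs_below H u v) \<le> card (verts H)"
  by (rule card_mono) (use assms in \<open>auto simp: simple_graph_def nbrs_below_def\<close>)

lemma A_values_le: "s \<in> A_values H i j \<Longrightarrow> s \<le> 3"
  by (auto simp: A_values_def)

(* The choice j' = i in (B) bounds the exponent by 2.001 on every edge ij, which makes
   the values 1, 3/2 and 2 in (A) redundant. *)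
lemma k_reg_bound_path:
  assumes "k_reg_bound H k" "simple_graph H" "{i, j} \<in> edges H" "{j, j'} \<in> edges H" "i \<le> j" "i \<le> j'"
  shows "real (card (nbrs_below H i j)) / 2 + real (card (nbrs_below H i j')) / 2 + 2 \<le> k"
proof -
  have verts: "i \<in> verts H" "j \<in> verts H" "j' \<in> verts H" using assms(2-4) by (auto simp: simple_graph_def)
  then have "real (card (nbrs_below H i j)) / 2 + real (card (nbrs_below H i j')) / 2
      + (if {i, j'} \<in> edges H then 2.501 else 2.001) \<le> k"
    using assms(1,3-6) unfolding k_reg_bound_def by auto
  then show ?thesis by (auto split: if_splits)
qed

(* (A) gives s = 3 only for the larger of the two back-degrees, which is the stronger bound. *)
lemma k_reg_bound_triangle:
  assumes k: "k_reg_bound H k" and H: "simple_graph H"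
    and e: "{i, j} \<in> edges H" "{j, l} \<in> edges H" "{i, l} \<in> edges H" and less: "i < j" "i < l"
  shows "real (card (nbrs_below H i i)) / 2 + real (card (nbrs_below H i j)) / 2 + 3 \<le> k"
proof -
  have *: "real (card (nbrs_below H i i)) / 2 + real (card (nbrs_below H i j)) / 2 + 3 \<le> k"
    if "{i, j} \<in> edges H" "{j, l} \<in> edges H" "{i, l} \<in> edges H" "i < j" "i < l"
      "card (nbrs_below H i l) \<le> card (nbrs_below H i j)" for j l
  proof -
    have "i \<in> verts H" "j \<in> verts H" using H that(1) by (auto simp: simple_graph_def)
    moreover have "3 \<in> A_values H i j" using that by (auto simp: A_values_def condA3_def)
    ultimately show ?thesis using k that unfolding k_reg_bound_def by auto
  qed
  show ?thesis
  proof (cases "card (nbrs_below H i l) \<le> card (nbrs_below H i j)")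
    case True
    then show ?thesis using * e less by blast
  next
    case False
    then have "real (card (nbrs_below H i i)) / 2 + real (card (nbrs_below H i l)) / 2 + 3 \<le> k"
      using *[of l j] e less by (simp add: insert_commute)
    then show ?thesis using False by simp
  qed
qed

text \<open>The conditions are non-strict lower bounds, so they hold at the infimum, which is thus
  the least element. An edge bounds the set below. Without edges the conditions are vacuous and hold
  for the unspecified value.\<close>

lemma k_reg_bound_k_reg:
  assumes H: "simple_graph H"
  shows "k_reg_bound H (k_reg H)"
proof (cases "edges H = {}")
  case True
  then show ?thesis by (simp add: k_reg_bound_def)
next
  case False
  then obtain i j where ij: "{i, j} \<in> edges H" "i \<le> j"
    using H unfolding simple_graph_def card_2_iff
    by (metis doubleton_eq_iff ex_in_conv linear)
  define S where "S = {k. k_reg_bound H k}"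
  have "0 \<le> k" if "k \<in> S" for k
    using k_reg_bound_path[OF _ H ij(1), of k i] that ij by (simp add: S_def insert_commute)
  then have bdd: "bdd_below S" by (rule bdd_belowI)
  define N where "N = real (card (verts H))"
  have "real (card (nbrs_below H u v)) / 2 + real (card (nbrs_below H u w)) / 2 + s \<le> N + 3" if "s \<le> 3" for u v w s
    using card_nbrs_below_le[OF H, of u v] card_nbrs_below_le[OF H, of u w] that unfolding N_def by linarith
  \<comment> \<open>Two halved back-degrees add up to at most N, and every additive constant is at
    most 3.\<close>
  then have "N + 3 \<in> S" unfolding S_def k_reg_bound_def by (auto dest: A_values_le)
  then have ne: "S \<noteq> {}" by blast
  have "k_reg_bound H (Inf S)"
    unfolding k_reg_bound_def
    by (intro ballI conjI impI cInf_greatest[OF ne]) (auto simp: S_def k_reg_bound_def)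
  moreover have "Inf S \<le> k" if "k_reg_bound H k" for k
    using that bdd by (intro cInf_lower) (auto simp: S_def)
  ultimately have "k_reg H = Inf S" unfolding k_reg_def by (intro Least_equality)
  then show ?thesis using \<open>k_reg_bound H (Inf S)\<close> by simp
qed

lemma powr_squared_le:
  fixes p k :: real
  assumes "0 < p" "p \<le> 1" "real N \<le> 2 * k"
  shows "(p powr k)\<^sup>2 \<le> p ^ N"
proof -
  have "(p powr k)\<^sup>2 = p powr (2 * k)" by (simp add: power2_eq_square flip: powr_add)
  also have "\<dots> \<le> p powr real N" using assms by (intro powr_mono') auto
  finally show ?thesis using assms by (simp add: powr_realpow)
qed

section \<open>From edge sets and p-densities to relations and cut bounds\<close>

lemma edges_between_eq_sum:
  assumes "finite U" "finite W" "U \<inter> W = {}"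
  shows "real (edges_between G U W) = (\<Sum>x\<in>U. \<Sum>y\<in>W. of_bool ({x, y} \<in> edges G))"
proof -
  define P where "P = {q \<in> U \<times> W. {fst q, snd q} \<in> edges G}"
  have "{e \<in> edges G. \<exists>u\<in>U. \<exists>w\<in>W. e = {u, w}} = (\<lambda>q. {fst q, snd q}) ` P"
  proof (intro equalityI subsetI)
    fix e assume "e \<in> {e \<in> edges G. \<exists>u\<in>U. \<exists>w\<in>W. e = {u, w}}"
    then obtain u w where "u \<in> U" "w \<in> W" "e = {u, w}" "e \<in> edges G" by blast
    then show "e \<in> (\<lambda>q. {fst q, snd q}) ` P"
      by (intro image_eqI[of _ _ "(u, w)"]) (simp_all add: P_def)
  qed (clarsimp simp: P_def, blast)
  \<comment> \<open>Disjointness of U and W lets an unordered edge determine its ordered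
    pair.\<close>
  moreover have "inj_on (\<lambda>q. {fst q, snd q}) P"
    using assms(3) by (intro inj_onI) (auto simp: P_def doubleton_eq_iff)
  ultimately have "edges_between G U W = card P" unfolding edges_between_def by (simp add: card_image)
  also have "real \<dots> = (\<Sum>q\<in>U \<times> W. of_bool ({fst q, snd q} \<in> edges G))"
    unfolding P_def using assms by (intro real_card_filter) auto
  finally show ?thesis unfolding sum.cartesian_product' by simp
qed

lemma sum_edges_minus_const:
  assumes "finite U" "finite W" "U \<inter> W = {}"
  shows "(\<Sum>x\<in>U. \<Sum>y\<in>W. of_bool ({x, y} \<in> edges G) - c)
    = real (edges_between G U W) - c * real (card U) * real (card W)"
  unfolding edges_between_eq_sum[OF assms] by (simp add: sum_subtractf mult_ac)

lemma bijumbled_imp_jumbled: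
  assumes "bijumbled G p b U W" "finite U" "finite W" "U \<inter> W = {}"
  shows "jumbled (\<lambda>x y. {x, y} \<in> edges G) p b U W"
  unfolding jumbled_def
proof (intro allI impI)
  fix X' Y' assume sub: "X' \<subseteq> U" "Y' \<subseteq> W"
  then have "finite X'" "finite Y'" "X' \<inter> Y' = {}" using assms finite_subset by blast+
  then show "\<bar>\<Sum>x\<in>X'. \<Sum>y\<in>Y'. of_bool ({x, y} \<in> edges G) - p\<bar> \<le> b * sqrt (real (card X') * real (card Y'))"
    using assms(1) sub unfolding bijumbled_def by (simp add: sum_edges_minus_const)
qed

lemma edges_between_mono:
  assumes "edges G \<subseteq> edges \<Gamma>" "finite U" "finite W" "U \<inter> W = {}"
  shows "real (edges_between G U W) \<le> real (edges_between \<Gamma> U W)"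
  unfolding edges_between_eq_sum[OF assms(2-4)] using assms(1)
  by (intro sum_mono) (auto simp: of_bool_def)

text \<open>Edges of G are bounded by those of the host graph. The error is measured by the full
  pair, which keeps the estimate useful for subpairs too small for regularity.\<close>

lemma bijumbled_edges_le:
  assumes J: "bijumbled \<Gamma> p (c * q * sqrt (real (card U) * real (card W))) U W"
    and sub: "edges G \<subseteq> edges \<Gamma>" and fin: "finite U" "finite W" and disj: "U \<inter> W = {}"
    and X: "X \<subseteq> U" and Y: "Y \<subseteq> W" and c: "0 \<le> c" and q: "0 \<le> q" "q \<le> p"
  shows "real (edges_between G X Y)
    \<le> p * (real (card X) * real (card Y)) + c * p * (real (card U) * real (card W))"
proof -
  have XY: "finite X" "finite Y" "X \<inter> Y = {}" using X Y fin disj finite_subset by blast+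
  have cc: "real (card X) * real (card Y) \<le> real (card U) * real (card W)"
    using X Y fin by (intro mult_mono) (auto intro: card_mono)
  have "real (edges_between G X Y) \<le> real (edges_between \<Gamma> X Y)" by (rule edges_between_mono[OF sub XY])
  also have "\<dots> \<le> p * real (card X) * real (card Y)
      + c * q * sqrt (real (card U) * real (card W)) * sqrt (real (card X) * real (card Y))"
    using J X Y unfolding bijumbled_def by (smt (verit))
  also have "c * q * sqrt (real (card U) * real (card W)) * sqrt (real (card X) * real (card Y))
      \<le> c * p * sqrt (real (card U) * real (card W)) * sqrt (real (card U) * real (card W))"
    using real_sqrt_le_mono[OF cc] c q by (intro mult_mono mult_nonneg_nonneg) auto
  also have "\<dots> = c * p * (real (card U) * real (card W))" by simp
  finally show ?thesis by simp
qed

lemma p_density_bounds: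
  assumes "bijumbled \<Gamma> p (c * q * sqrt (real (card U) * real (card W))) U W"
    "edges G \<subseteq> edges \<Gamma>" "finite U" "finite W" "U \<inter> W = {}" "0 \<le> c" "c \<le> 1" "0 \<le> q" "q \<le> p"
  shows "0 \<le> p_density G p U W" "p_density G p U W \<le> 2"
proof -
  have p: "0 \<le> p" using assms by simp
  show "0 \<le> p_density G p U W" unfolding p_density_def using p by simp
  define N where "N = p * real (card U) * real (card W)"
  have N: "0 \<le> N" unfolding N_def using p by simp
  have "real (edges_between G U W) \<le> N + c * N"
    using bijumbled_edges_le[OF assms(1-5) order_refl order_refl assms(6,8,9)] unfolding N_def by (simp add: mult_ac)
  also have "\<dots> \<le> 2 * N" using assms(7) N mult_right_mono[of c 1 N] by simp
  finally show "p_density G p U W \<le> 2"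
    \<comment> \<open>For N = 0 the density is 0, by the convention for division by 0.\<close>
    unfolding p_density_def N_def[symmetric] using N by (cases "N = 0") (auto simp: pos_divide_le_eq)
qed

text \<open>Regularity handles large subpairs. If a side is too small,
  \<open>k \<le> \<epsilon> * N\<close>, and both the edge count and the prediction are small on
  their own: the former by jumbledness of the host graph, the latter because the density is at most
  2.\<close>

lemma regular_pair_imp_cut_bounded:
  assumes R: "regular_pair G \<epsilon> p U W"
    and J: "bijumbled \<Gamma> p (c * q * sqrt (real (card U) * real (card W))) U W"
    and sub: "edges G \<subseteq> edges \<Gamma>" and fin: "finite U" "finite W" and disj: "U \<inter> W = {}"
    and c: "0 \<le> c" "c \<le> 1" and q: "0 \<le> q" "q \<le> p" and \<epsilon>: "0 \<le> \<epsilon>" and p: "0 < p"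
  shows "cut_bounded (\<lambda>x y. of_bool ({x, y} \<in> edges G) - p_density G p U W * p)
    ((2 * \<epsilon> + c) * p * real (card U) * real (card W)) U W"
  unfolding cut_bounded_def
proof (intro allI impI)
  fix X Y assume X: "X \<subseteq> U" and Y: "Y \<subseteq> W"
  define D where "D = p_density G p U W"
  define N where "N = real (card U) * real (card W)"
  define k where "k = real (card X) * real (card Y)"
  define e where "e = real (edges_between G X Y)"
  have D: "0 \<le> D" "D \<le> 2" unfolding D_def using p_density_bounds[OF J sub fin disj c q] by auto
  have XY: "finite X" "finite Y" "X \<inter> Y = {}" using X Y fin disj finite_subset by blast+
  have cX: "real (card X) \<le> real (card U)" and cY: "real (card Y) \<le> real (card W)"
    using X Y fin by (auto intro: card_mono)
  have k: "0 \<le> k" "k \<le> N" unfolding k_def N_def using cX cY by (auto intro: mult_mono)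
  have N: "0 \<le> N" unfolding N_def by simp
  have "\<bar>e - D * p * k\<bar> \<le> (2 * \<epsilon> + c) * p * N"
  proof (cases "\<epsilon> * real (card U) \<le> real (card X) \<and> \<epsilon> * real (card W) \<le> real (card Y)")
    case True
    show ?thesis
    \<comment> \<open>Multiplying the density back by \<open>p * k\<close> recovers the edge count
      only for nonzero k.\<close>
    proof (cases "k = 0")
      case True
      then have "X = {} \<or> Y = {}" using XY by (auto simp: k_def)
      then have "e = 0" unfolding e_def edges_between_eq_sum[OF XY] by auto
      then show ?thesis using True \<epsilon> c p N by simp
    next
      case False
      then have kpos: "0 < k" using k by simp
      have "\<bar>p_density G p X Y - D\<bar> \<le> \<epsilon>"
        using R X Y True unfolding regular_pair_def D_def by blast
      then have "\<bar>p_density G p X Y - D\<bar> * (p * k) \<le> \<epsilon> * (p * k)" using p k by (intro mult_right_mono) auto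
      moreover have "\<bar>p_density G p X Y - D\<bar> * (p * k) = \<bar>(p_density G p X Y - D) * (p * k)\<bar>"
        using p k by (simp add: abs_mult)
      moreover have "p_density G p X Y * (p * k) = e"
        unfolding p_density_def e_def mult.assoc k_def[symmetric] using p kpos by simp
      ultimately have "\<bar>e - D * p * k\<bar> \<le> \<epsilon> * (p * k)" by (simp add: left_diff_distrib mult.assoc)
      also have "\<dots> \<le> (2 * \<epsilon> + c) * (p * N)" using \<epsilon> c p k by (intro mult_mono) auto
      finally show ?thesis by (simp add: mult.assoc)
    qed
  next
    case False
    have "k \<le> \<epsilon> * N"
    proof (cases "\<epsilon> * real (card U) \<le> real (card X)")
      case True
      then have "real (card Y) \<le> \<epsilon> * real (card W)" using False by linarith
      then have "k \<le> real (card U) * (\<epsilon> * real (card W))" unfolding k_def using cX by (intro mult_mono) auto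
      then show ?thesis by (simp add: N_def mult_ac)
    next
      case False
      then have "k \<le> (\<epsilon> * real (card U)) * real (card W)" unfolding k_def using cY \<epsilon> by (intro mult_mono) auto
      then show ?thesis by (simp add: N_def mult_ac)
    qed
    then have pk: "p * k \<le> \<epsilon> * p * N" using mult_left_mono[of k "\<epsilon> * N" p] p by (simp add: mult_ac)
    have "e \<le> p * k + c * p * N"
      unfolding e_def k_def N_def by (rule bijumbled_edges_le[OF J sub fin disj X Y c(1) q])
    moreover have "D * p * k \<le> 2 * (\<epsilon> * p * N)"
      using D pk p k mult_mono[of D 2 "p * k" "\<epsilon> * p * N"] by (simp add: mult.assoc)
    moreover have "0 \<le> e" "0 \<le> D * p * k" unfolding e_def using D p k by simp_all
    moreover have "0 \<le> \<epsilon> * p * N" "0 \<le> c * p * N" using \<epsilon> c p N by simp_all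
    moreover have "(2 * \<epsilon> + c) * p * N = 2 * (\<epsilon> * p * N) + c * p * N" by (simp add: algebra_simps)
    ultimately show ?thesis using pk by linarith
  qed
  then show "\<bar>\<Sum>x\<in>X. \<Sum>y\<in>Y. of_bool ({x, y} \<in> edges G) - p_density G p U W * p\<bar>
      \<le> (2 * \<epsilon> + c) * p * real (card U) * real (card W)"
    unfolding sum_edges_minus_const[OF XY] D_def e_def k_def N_def by (simp add: mult_ac)
qed

lemma edges_between_commute: "edges_between G U W = edges_between G W U"
  unfolding edges_between_def by (intro arg_cong[where f = card] Collect_cong) (metis insert_commute)

lemma p_density_commute: "p_density G p U W = p_density G p W U"
  unfolding p_density_def by (simp add: edges_between_commute[of G U W] mult_ac)

lemma card_edges_eq:
  assumes "simple_graph H" "verts H = {1..m}"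
  shows "card (edges H) = card (forward_edges H 1)"
proof -
  have "edges H = (\<lambda>(j, k). {j, k}) ` forward_edges H 1"
  proof (rule set_eqI)
    fix e
    show "e \<in> edges H \<longleftrightarrow> e \<in> (\<lambda>(j, k). {j, k}) ` forward_edges H 1"
    proof
      assume e: "e \<in> edges H"
      then have "card e = 2" using assms by (auto simp: simple_graph_def)
      then obtain a b where "e = {a, b}" "a \<noteq> b" by (auto simp: card_2_iff)
      then obtain j k where jk: "e = {j, k}" "j < k" by (metis insert_commute linorder_neqE_nat)
      then have "adj H j k" using e by (simp add: adj_def)
      then have "(j, k) \<in> forward_edges H 1"
        using adj_in_verts[OF assms, of j k] jk by (simp add: forward_edges_def)
      then show "e \<in> (\<lambda>(j, k). {j, k}) ` forward_edges H 1" using jk by force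
    qed (auto simp: forward_edges_def adj_def)
  qed
  moreover have "inj_on (\<lambda>(j, k). {j, k}) (forward_edges H 1)"
    by (auto simp: inj_on_def forward_edges_def doubleton_eq_iff)
  ultimately show ?thesis by (simp add: card_image)
qed

theorem lemma23:
  fixes H :: "nat ugraph" and m :: nat and \<gamma> :: real
  assumes "simple_graph H" and "verts H = {1..m}" and "\<gamma> > 0"
  shows "\<exists>\<epsilon> c :: real. \<epsilon> > 0 \<and> c > 0 \<and>
    (\<forall>(p :: real) (G :: 'v ugraph) (\<Gamma> :: 'v ugraph) (V :: nat \<Rightarrow> 'v set).
      0 < p \<and> p \<le> 1 \<and>
      simple_graph G \<and> simple_graph \<Gamma> \<and> subgraph G \<Gamma> \<and>
      (\<forall>i\<in>{1..m}. V i \<subseteq> verts G) \<and>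
      (\<forall>i j. {i, j} \<in> edges H \<longrightarrow>
        V i \<inter> V j = {} \<and>
        regular_pair G \<epsilon> p (V i) (V j) \<and>
        bijumbled \<Gamma> p
          (c * p powr k_reg H * sqrt (real (card (V i)) * real (card (V j)))) (V i) (V j)) \<longrightarrow>
      real (num_copies H G V) \<ge>
        (graph_density H G p V - \<gamma>) * p ^ card (edges H) * (\<Prod>i\<in>{1..m}. real (card (V i))))"
proof -
  note H = assms(1,2)
  have "\<exists>\<eta>>0. \<eta> \<le> 1 \<and> (\<forall>p q (E :: 'v \<Rightarrow> 'v \<Rightarrow> bool) W n d C.
    counting_frame H m p q E W n d \<longrightarrow> counting_frame.regular_state H m p q E W n d 1 1 \<eta> C \<longrightarrow>
    (\<Prod>(j, k)\<in>forward_edges H 1. d j k * p) * (\<Prod>j\<in>{1..m}. real (card (C j)))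
      - \<gamma> * p ^ card (forward_edges H 1) * (\<Prod>j\<in>{1..m}. scale H p n 1 j)
    \<le> real (card (partial_copies H m E 1 C)))"
    by (rule partial_copies_lower_bound[OF H]) (use assms(3) in auto)
  then obtain \<eta> where \<eta>: "0 < \<eta>" "\<eta> \<le> 1" and count: "\<And>p q (E :: 'v \<Rightarrow> 'v \<Rightarrow> bool) W n d C.
    counting_frame H m p q E W n d \<Longrightarrow> counting_frame.regular_state H m p q E W n d 1 1 \<eta> C \<Longrightarrow>
    (\<Prod>(j, k)\<in>forward_edges H 1. d j k * p) * (\<Prod>j\<in>{1..m}. real (card (C j)))
      - \<gamma> * p ^ card (forward_edges H 1) * (\<Prod>j\<in>{1..m}. scale H p n 1 j)
    \<le> real (card (partial_copies H m E 1 C))" by blast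
  \<comment> \<open>c also serves as \<open>\<epsilon>\<close>, and the cut bound has error
    \<open>2 * \<epsilon> + c\<close>, hence the third.\<close>
  define c where "c = \<eta> / 3"
  have c: "0 < c" "c \<le> 1" "2 * c + c = \<eta>" "c \<le> \<eta>" unfolding c_def using \<eta> by simp_all
  show ?thesis
  proof (intro exI[of _ c] conjI allI impI c(1))
    fix p :: real and G \<Gamma> :: "'v ugraph" and V :: "nat \<Rightarrow> 'v set"
    assume A: "0 < p \<and> p \<le> 1 \<and>
      simple_graph G \<and> simple_graph \<Gamma> \<and> subgraph G \<Gamma> \<and>
      (\<forall>i\<in>{1..m}. V i \<subseteq> verts G) \<and>
      (\<forall>i j. {i, j} \<in> edges H \<longrightarrow>
        V i \<inter> V j = {} \<and>
        regular_pair G c p (V i) (V j) \<and>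
        bijumbled \<Gamma> p
          (c * p powr k_reg H * sqrt (real (card (V i)) * real (card (V j)))) (V i) (V j))"
    define q where "q = p powr k_reg H"
    define E where "E = (\<lambda>x y :: 'v. {x, y} \<in> edges G)"
    define W where "W = (\<lambda>x y :: 'v. {x, y} \<in> edges \<Gamma>)"
    define n where "n j = real (card (V j))" for j
    define d where "d j k = p_density G p (V j) (V k)" for j k
    have p: "0 < p" "p \<le> 1" and sub: "edges G \<subseteq> edges \<Gamma>" using A by (auto simp: subgraph_def)
    have finV: "finite (V j)" if "j \<in> {1..m}" for j
      using A that unfolding simple_graph_def by (meson finite_subset)
    have pair: "V j \<inter> V k = {}" "regular_pair G c p (V j) (V k)"
      "bijumbled \<Gamma> p (c * q * sqrt (real (card (V j)) * real (card (V k)))) (V j) (V k)"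
      if "adj H j k" for j k
      using A that unfolding adj_def q_def by auto
    have q0: "0 \<le> q" unfolding q_def by simp
    note bound = k_reg_bound_k_reg[OF H(1)]
    \<comment> \<open>This is claimed only in the presence of an edge, since otherwise
      \<open>k_reg H\<close> is unspecified. The walk j, k, j gives exponent at least 2.\<close>
    have q_le: "q \<le> p" if jk: "adj H j k" for j k
    proof -
      have "2 \<le> k_reg H"
      proof -
        have "2 \<le> k_reg H" if "adj H j k" "j \<le> k" for j k
          using k_reg_bound_path[OF bound H(1), of j k j] that by (simp add: adj_def insert_commute)
        then show ?thesis using jk adj_commute[of H j k] by (metis linear)
      qed
      then have "q \<le> p powr 1" unfolding q_def using p by (intro powr_mono') auto
      then show ?thesis using p by simp
    qed
    have fr: "counting_frame H m p q E W n d"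
    proof
      show "q\<^sup>2 \<le> p ^ (4 + card (nbrs_below H i j) + card (nbrs_below H i k))"
        if "i < j" "i \<le> k" "adj H i j" "adj H j k" for i j k
        unfolding q_def using that k_reg_bound_path[OF bound H(1), of i j k]
        by (intro powr_squared_le p) (simp add: adj_def)
      show "q\<^sup>2 \<le> p ^ (6 + card (nbrs_below H i j) + card (nbrs_below H i i))"
        if "i < j" "i < k" "adj H i j" "adj H j k" "adj H i k" for i j k
        unfolding q_def using that k_reg_bound_triangle[OF bound H(1), of i j k]
        by (intro powr_squared_le p) (simp add: adj_def)
      show "d j k = d k j" for j k unfolding d_def by (rule p_density_commute)
      show "0 \<le> d j k" "d j k \<le> 2" if "adj H j k" for j k
        unfolding d_def using that pair[OF that] sub finV adj_in_verts[OF H that] c q0 q_le[OF that]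
        by (auto intro!: p_density_bounds[where c = c and q = q and \<Gamma> = \<Gamma>])
    qed (use H p q0 sub in \<open>auto simp: n_def E_def W_def insert_commute\<close>)
    have scale: "scale H p n 1 j = n j" for j
    proof -
      \<comment> \<open>Vertices are numbered from 1, so only 0 lies below the starting index and it
        is not a vertex.\<close>
      have "nbrs_below H 1 j = {}"
        using adj_in_verts[OF H, of j 0] by (auto simp: nbrs_below_def adj_def)
      then show ?thesis by (simp add: scale_def)
    qed
    have st: "counting_frame.regular_state H m p q E W n d 1 1 \<eta> V"
      unfolding counting_frame.regular_state_def[OF fr] scale
    proof (intro conjI ballI impI)
      fix j assume "j \<in> {1..m}"
      then show "finite (V j)" "real (card (V j)) \<le> 1 * n j" by (simp_all add: finV n_def)
    next
      fix j k assume jk: "j \<in> {1..m}" "k \<in> {1..m}" "adj H j k"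
      note pair = pair[OF jk(3)]
      have "c * q * sqrt (n j * n k) \<le> \<eta> * q * sqrt (n j * n k)"
        using c q0 by (intro mult_right_mono) (auto simp: n_def)
      then show "jumbled W p (\<eta> * q * sqrt (n j * n k)) (V j) (V k)"
        using bijumbled_imp_jumbled[OF pair(3) finV[OF jk(1)] finV[OF jk(2)] pair(1)]
        unfolding W_def n_def by (rule jumbled_mono[rotated])
      show "cut_bounded (\<lambda>x y. of_bool (E x y) - d j k * p) (\<eta> * p * n j * n k) (V j) (V k)"
        using regular_pair_imp_cut_bounded[OF pair(2,3) sub finV[OF jk(1)] finV[OF jk(2)] pair(1)
            order_less_imp_le[OF c(1)] c(2) q0 q_le[OF jk(3)] order_less_imp_le[OF c(1)] p(1)]
        unfolding c(3) E_def d_def n_def .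
    qed
    have copies: "num_copies H G V = card (partial_copies H m E 1 V)"
    proof -
      have "{j, k} \<in> edges H \<Longrightarrow> j \<in> {1..m} \<and> k \<in> {1..m}" for j k
        using adj_in_verts[OF H, of j k] by (simp add: adj_def)
      then show ?thesis
        unfolding num_copies_def partial_copies_def H(2) E_def adj_def
        by (intro arg_cong[where f = card] Collect_cong) blast
    qed
    have "forward_edges H 1 = {(i, j). i < j \<and> {i, j} \<in> edges H}"
      using adj_in_verts[OF H] by (force simp: forward_edges_def adj_def)
    then have density: "(\<Prod>(j, k)\<in>forward_edges H 1. d j k * p) = graph_density H G p V * p ^ card (edges H)"
      unfolding graph_density_def d_def card_edges_eq[OF H]
      by (simp add: case_prod_unfold prod.distrib)
    have "graph_density H G p V * p ^ card (edges H) * (\<Prod>j\<in>{1..m}. n j)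
        - \<gamma> * p ^ card (edges H) * (\<Prod>j\<in>{1..m}. n j) \<le> real (num_copies H G V)"
      using count[OF fr st] unfolding density scale copies card_edges_eq[OF H] n_def .
    then show "(graph_density H G p V - \<gamma>) * p ^ card (edges H) * (\<Prod>i\<in>{1..m}. real (card (V i)))
        \<le> real (num_copies H G V)"
      unfolding n_def by (simp only: left_diff_distrib)
  qed
qed

end
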